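(* Let $d\ge 1$ and let $r$ be a prime number. Then every BMZ-collection $\mathcal{C}=(C_1,\ldots,C_{d+2})$ in $\mathbb{R}^d$ (for these $d$ and $r$) admits a Tverberg rainbow $r$-partition, i.e., there exist pairwise disjoint sets $R_1,\ldots,R_r\subseteq C_1\cup\cdots\cup C_{d+2}$ such that $|R_i\cap C_j|\le 1$ for all $i\in[r]$ and $j\in[d+2]$, and $\bigcap_{i=1}^r\operatorname{conv}(R_i)\neq\emptyset$.
   Context: A BMZ-collection (for given $d,r$) is a $(d+2)$-tuple $\mathcal{C}=(C_1,\ldots,C_{d+2})$ of pairwise disjoint finite subsets of $\mathbb{R}^d$ with $|C_1|=\cdots=|C_{d+1}|=r-1$ and $|C_{d+2}|=1$. $[k]=\{1,\ldots,k\}$. The sets $R_i$ are not required to cover the ground set. *)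

theory Defs
  imports "HOL-Analysis.Analysis" "HOL-Computational_Algebra.Primes"
begin

definition BMZ_collection :: "nat \<Rightarrow> (nat \<Rightarrow> 'a::euclidean_space set) \<Rightarrow> bool" where
  "BMZ_collection r C \<longleftrightarrow>
     (\<forall>j\<in>{1..DIM('a)+2}. finite (C j)) \<and>
     (\<forall>i\<in>{1..DIM('a)+2}. \<forall>j\<in>{1..DIM('a)+2}. i \<noteq> j \<longrightarrow> C i \<inter> C j = {}) \<and>
     (\<forall>j\<in>{1..DIM('a)+1}. card (C j) = r - 1) \<and>
     card (C (DIM('a)+2)) = 1"

definition Tverberg_rainbow_partition ::
  "nat \<Rightarrow> (nat \<Rightarrow> 'a::euclidean_space set) \<Rightarrow> (nat \<Rightarrow> 'a set) \<Rightarrow> bool" where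
  "Tverberg_rainbow_partition r C R \<longleftrightarrow>
     (\<forall>i\<in>{1..r}. \<forall>k\<in>{1..r}. i \<noteq> k \<longrightarrow> R i \<inter> R k = {}) \<and>
     (\<forall>i\<in>{1..r}. R i \<subseteq> (\<Union>j\<in>{1..DIM('a)+2}. C j)) \<and>
     (\<forall>i\<in>{1..r}. \<forall>j\<in>{1..DIM('a)+2}. card (R i \<inter> C j) \<le> 1) \<and>
     (\<Inter>i\<in>{1..r}. convex hull (R i)) \<noteq> {}"

end

theory Submission
  imports Defs "Jordan_Normal_Form.Determinant"
begin

no_notation scalar_prod (infix "\<bullet>" 70)

text \<open>
  Sarkaria's transform places \<open>r\<close> copies of each point, one per color, in the quotient of
  \<open>(\<real>\<^sup>d\<^sup>+\<^sup>1)\<^sup>r\<close> by the diagonal. Colorings of the first \<open>d + 1\<close> classes that are injective on each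
  class are the facets of a pseudomanifold in which two facets sharing a ridge differ by a
  transposition. The degree of this pseudomanifold about the origin is the signed number of facets
  whose cone contains a generic vector \<open>v\<close>. When one point of a configuration in general position is
  moved, the degree changes by a sum of terms that is invariant under the cyclic shift of the colors,
  hence by a multiple of \<open>r\<close>. If all points of the \<open>j\<close>-th class sit at the \<open>j\<close>-th unit vector, the
  degree is \<open>((r - 1)!)\<^sup>d\<^sup>+\<^sup>1\<close>, which the prime \<open>r\<close> does not divide. So the degree of a slight
  perturbation of the given configuration is nonzero. With \<open>v\<close> the negative of the copy in color \<open>0\<close>
  of the single point of the last class, a facet whose cone contains \<open>v\<close> is a rainbow partition with
  intersecting hulls. If there is no such partition, separating functionals, which survive a small
  perturbation, force the degree to be \<open>0\<close>.
\<close>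

subsection \<open>Determinants of column families\<close>

definition cdet :: "nat \<Rightarrow> (nat \<Rightarrow> nat \<Rightarrow> real) \<Rightarrow> real" where
  "cdet m F = Determinant.det (Matrix.mat m m (\<lambda>(i, k). F k i))"

lemma cdet_cong:
  assumes "\<And>k i. k < m \<Longrightarrow> i < m \<Longrightarrow> F k i = G k i"
  shows "cdet m F = cdet m G"
proof -
  have "Matrix.mat m m (\<lambda>(i, k). F k i) = Matrix.mat m m (\<lambda>(i, k). G k i)"
    by (rule Matrix.eq_matI) (auto simp: assms)
  then show ?thesis by (simp add: cdet_def)
qed

lemma cdet_permute_rows:
  assumes "p permutes {..<m}"
  shows "cdet m (\<lambda>k i. F k (p i)) = of_int (sign p) * cdet m F"
proof -
  let ?A = "Matrix.mat m m (\<lambda>(i, k). F k i)"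
  have p: "p permutes {0..<m}" using assms by (simp add: lessThan_atLeast0)
  have lt: "p i < m" if "i < m" for i
    using permutes_in_image[OF assms, of i] that by simp
  have "Matrix.mat m m (\<lambda>(i, j). ?A $$ (p i, j)) = Matrix.mat m m (\<lambda>(i, k). F k (p i))"
    by (rule Matrix.eq_matI) (auto simp: lt)
  then show ?thesis
    using det_permute_rows[of ?A m p] p by (simp add: cdet_def)
qed

lemma cdet_cramer:
  assumes v: "\<And>i. i < m \<Longrightarrow> v i = (\<Sum>k<m. s k * F k i)" and l: "l < m"
  shows "cdet m (F(l := v)) = s l * cdet m F"
proof -
  let ?A = "Matrix.mat m m (\<lambda>(i, k). F k i)"
  let ?x = "Matrix.vec m s"
  have "Matrix.mat m m (\<lambda>(i, k). (F(l := v)) k i) = replace_col ?A (?A *\<^sub>v ?x) l"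
    unfolding replace_col_def
    by (rule Matrix.eq_matI)
      (auto simp: v scalar_prod_def lessThan_atLeast0 mult.commute intro!: sum.cong)
  then show ?thesis
    using cramer_lemma_mat[of ?A m ?x l] l by (simp add: cdet_def)
qed

lemma cdet_solve:
  assumes "cdet m F \<noteq> 0"
  obtains s where "\<And>i. i < m \<Longrightarrow> v i = (\<Sum>k<m. s k * F k i)"
proof -
  let ?A = "Matrix.mat m m (\<lambda>(i, k). F k i)"
  let ?B = "adj_mat ?A"
  have A: "?A \<in> carrier_mat m m" by simp
  note adj = adj_mat[OF A]
  define s where "s k = (\<Sum>j<m. ?B $$ (k, j) * v j) / cdet m F" for k
  have AB: "(\<Sum>k<m. F k i * ?B $$ (k, j)) = (if i = j then cdet m F else 0)"
    if "i < m" "j < m" for i j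
  proof -
    have "(?A * ?B) $$ (i, j) = (\<Sum>k<m. F k i * ?B $$ (k, j))"
      using adj(1) that by (auto simp: scalar_prod_def lessThan_atLeast0 intro!: sum.cong)
    then show ?thesis using adj(2) that by (auto simp: cdet_def)
  qed
  have "v i = (\<Sum>k<m. s k * F k i)" if i: "i < m" for i
  proof -
    have "cdet m F * (\<Sum>k<m. s k * F k i) = (\<Sum>k<m. \<Sum>j<m. F k i * ?B $$ (k, j) * v j)"
      unfolding sum_distrib_left[of "cdet m F"]
    proof (intro sum.cong refl)
      fix k assume "k \<in> {..<m}"
      have "cdet m F * (s k * F k i) = F k i * (\<Sum>j<m. ?B $$ (k, j) * v j)"
        using assms by (simp add: s_def)
      then show "cdet m F * (s k * F k i) = (\<Sum>j<m. F k i * ?B $$ (k, j) * v j)"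
        by (simp add: sum_distrib_left mult.assoc)
    qed
    also have "\<dots> = (\<Sum>j<m. (\<Sum>k<m. F k i * ?B $$ (k, j)) * v j)"
      by (subst sum.swap) (simp add: sum_distrib_right)
    also have "\<dots> = (\<Sum>j<m. if i = j then cdet m F * v j else 0)"
      by (intro sum.cong refl) (simp add: AB i)
    also have "\<dots> = cdet m F * v i" using i by simp
    finally show ?thesis using assms by simp
  qed
  then show ?thesis using that by blast
qed

lemma cdet_poly:
  assumes "\<And>k i. k < m \<Longrightarrow> i < m \<Longrightarrow> \<exists>p. \<forall>t. F t k i = poly p t"
  shows "\<exists>p. \<forall>t. cdet m (F t) = poly p t"
proof -
  obtain P where P: "\<And>k i t. k < m \<Longrightarrow> i < m \<Longrightarrow> F t k i = poly (P k i) t"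
    using assms by metis
  define p where "p = (\<Sum>q | q permutes {0..<m}.
    of_int (sign q) * (\<Prod>i = 0..<m. P (q i) i))"
  have "cdet m (F t) = poly p t" for t
  proof -
    have "cdet m (F t) = (\<Sum>q | q permutes {0..<m}. of_int (sign q) *
        (\<Prod>i = 0..<m. Matrix.mat m m (\<lambda>(i, k). F t k i) $$ (i, q i)))"
      unfolding cdet_def by (rule Determinant.det_def') simp
    also have "\<dots> = poly p t"
      unfolding p_def poly_sum poly_mult poly_prod
    proof (intro sum.cong refl arg_cong2[where f = "(*)"] prod.cong)
      fix q i assume "q \<in> {q. q permutes {0..<m}}" "i \<in> {0..<m}"
      then show "Matrix.mat m m (\<lambda>(i, k). F t k i) $$ (i, q i) = poly (P (q i) i) t"
        using permutes_in_image[of q "{0..<m}" i] by (auto simp: P)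
    qed simp
    finally show ?thesis .
  qed
  then show ?thesis by blast
qed

lemma cdet_lower_triangular:
  assumes "\<And>i k. i < k \<Longrightarrow> k < m \<Longrightarrow> F k i = 0" and "\<And>k. k < m \<Longrightarrow> F k k = 1"
  shows "cdet m F = 1"
proof -
  have "cdet m F = prod_list (diag_mat (Matrix.mat m m (\<lambda>(i, k). F k i)))"
    unfolding cdet_def by (rule det_lower_triangular[of m]) (auto simp: assms)
  also have "\<dots> = (\<Prod>i = 0..<m. 1)"
    unfolding prod_list_diag_prod by (intro prod.cong) (auto simp: assms)
  finally show ?thesis by simp
qed

subsection \<open>Signed cones\<close>

text \<open>Read \<open>t k\<close> as positions on a line. A positive \<open>l\<close> counts iff
  all other positive indices lie to its right and all negative ones to its left. Only the leftmost
  positive index can do so, hence the sum is 0 or 1.\<close>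

lemma sum_positive_separating:
  fixes lam t :: "'b \<Rightarrow> real"
  assumes fin: "finite J" and nz: "\<And>k. k \<in> J \<Longrightarrow> lam k \<noteq> 0" and inj: "inj_on t J"
  shows "(\<Sum>l | l \<in> J \<and> lam l > 0. if \<forall>k\<in>J - {l}. lam k * (t k - t l) > 0 then 1 else 0 :: int) =
    (if (\<exists>k\<in>J. lam k > 0) \<and> (\<forall>n\<in>J. \<forall>p\<in>J. lam n < 0 \<longrightarrow> lam p > 0 \<longrightarrow> t n < t p) then 1 else 0)"
    (is "(\<Sum>l\<in>?P. if ?val l then 1 else 0) = (if ?ne \<and> ?sep then 1 else 0)")
proof (cases "?ne \<and> ?sep")
  case True
  have "finite ?P" "?P \<noteq> {}" using fin True by auto
  then obtain p where p: "p \<in> ?P" and min: "\<And>k. k \<in> ?P \<Longrightarrow> t p \<le> t k"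
    by (metis (no_types, lifting) arg_min_if_finite(1) arg_min_least)
  have "?val l \<longleftrightarrow> l = p" if l: "l \<in> ?P" for l
  proof
    assume v: "?val l"
    show "l = p"
    proof (rule ccontr)
      assume "l \<noteq> p"
      then have "lam p * (t p - t l) > 0" using v p by auto
      then have "t p > t l" using p by (simp add: zero_less_mult_iff)
      then show False using min[OF l] by simp
    qed
  next
    assume lp: "l = p"
    show "?val l"
    proof
      fix k assume k: "k \<in> J - {l}"
      show "lam k * (t k - t l) > 0"
      proof (cases "lam k > 0")
        case True
        then have "t p \<le> t k" using min k by auto
        moreover have "t p \<noteq> t k" using inj k p lp by (auto simp: inj_on_def)
        ultimately show ?thesis using True lp by simp
      next
        case False
        then have "lam k < 0" using nz[of k] k by auto
        moreover have "t k < t p" using \<open>?ne \<and> ?sep\<close> p k calculation by auto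
        ultimately show ?thesis using lp by (simp add: mult_neg_neg)
      qed
    qed
  qed
  then have "(\<Sum>l\<in>?P. if ?val l then 1 else 0 :: int) = (\<Sum>l\<in>?P. if l = p then 1 else 0)"
    by (intro sum.cong) auto
  then show ?thesis using True p fin by simp
next
  case False
  have "\<not> ?val l" if l: "l \<in> ?P" for l
  proof
    assume v: "?val l"
    have "t n < t p" if n: "n \<in> J" "lam n < 0" and p: "p \<in> J" "lam p > 0" for n p
    proof -
      have "lam n * (t n - t l) > 0" using v n l by auto
      then have a: "t n < t l" using n by (simp add: zero_less_mult_iff)
      have "t l \<le> t p"
      proof (cases "p = l")
        case False
        then have "lam p * (t p - t l) > 0" using v p by auto
        then show ?thesis using p by (simp add: zero_less_mult_iff)
      qed simp
      with a show ?thesis by simp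
    qed
    then show False using False l by auto
  qed
  then have "(\<Sum>l\<in>?P. if ?val l then 1 else 0 :: int) = (\<Sum>l\<in>?P. 0)"
    by (intro sum.cong refl if_not_P)
  then show ?thesis using False by (simp only: if_False sum.neutral_const)
qed

text \<open>Negating both \<open>lam\<close> and \<open>t\<close> reduces the negative indices to
  the positive case. If both signs occur, the two contributions cancel; otherwise only one is
  present and its separation condition is vacuous.\<close>

lemma sum_sgn_separating:
  fixes lam t :: "'b \<Rightarrow> real"
  assumes fin: "finite J" and ne: "J \<noteq> {}" and nz: "\<And>k. k \<in> J \<Longrightarrow> lam k \<noteq> 0"
    and inj: "inj_on t J"
  shows "(\<Sum>l\<in>J. if \<forall>k\<in>J - {l}. lam k * (t k - t l) > 0
      then if lam l > 0 then 1 else - 1 else 0 :: int) =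
    (if \<forall>k\<in>J. lam k > 0 then 1 else 0) - (if \<forall>k\<in>J. lam k < 0 then 1 else 0)"
    (is "(\<Sum>l\<in>J. if ?val l then ?s l else 0) = _")
proof -
  let ?P = "{l. l \<in> J \<and> lam l > 0}" and ?N = "{l. l \<in> J \<and> lam l < 0}"
  let ?sep = "\<forall>n\<in>J. \<forall>p\<in>J. lam n < 0 \<longrightarrow> lam p > 0 \<longrightarrow> t n < t p"
  have J: "J = ?P \<union> ?N" using nz by force
  have "(\<Sum>l\<in>J. if ?val l then ?s l else 0) =
      (\<Sum>l\<in>?P. if ?val l then ?s l else 0) + (\<Sum>l\<in>?N. if ?val l then ?s l else 0)"
    using fin by (subst (1) J, subst sum.union_disjoint) auto
  also have "(\<Sum>l\<in>?P. if ?val l then ?s l else 0) = (\<Sum>l\<in>?P. if ?val l then 1 else 0)"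
    by (intro sum.cong) auto
  also have "\<dots> = (if (\<exists>k\<in>J. lam k > 0) \<and> ?sep then 1 else 0)"
    by (rule sum_positive_separating[OF fin nz inj])
  also have "(\<Sum>l\<in>?N. if ?val l then ?s l else 0) = - (\<Sum>l\<in>?N. if ?val l then 1 else 0)"
    unfolding sum_negf[symmetric] by (intro sum.cong) auto
  also have "(\<Sum>l\<in>?N. if ?val l then 1 else 0 :: int) =
      (\<Sum>l | l \<in> J \<and> - lam l > 0. if \<forall>k\<in>J - {l}. - lam k * (- t k - - t l) > 0 then 1 else 0)"
  proof (intro sum.cong if_cong refl ball_cong)
    fix k x assume "k \<in> J - {x}"
    show "(0 < lam k * (t k - t x)) = (0 < - lam k * (- t k - - t x))"
      by (simp add: algebra_simps)
  qed auto
  also have "\<dots> = (if (\<exists>k\<in>J. - lam k > 0) \<and>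
      (\<forall>n\<in>J. \<forall>p\<in>J. - lam n < 0 \<longrightarrow> - lam p > 0 \<longrightarrow> - t n < - t p) then 1 else 0)"
    using nz inj by (intro sum_positive_separating fin) (auto simp: inj_on_def)
  also have "\<dots> = (if (\<exists>k\<in>J. lam k < 0) \<and> ?sep then 1 else 0)" by auto
  also have "(if (\<exists>k\<in>J. lam k > 0) \<and> ?sep then 1 else 0) + - (if (\<exists>k\<in>J. lam k < 0) \<and> ?sep then 1 else 0) =
      (if \<forall>k\<in>J. lam k > 0 then 1 else 0) - (if \<forall>k\<in>J. lam k < 0 then 1 else 0 :: int)"
  proof (cases "(\<exists>k\<in>J. lam k > 0) \<and> (\<exists>k\<in>J. lam k < 0)")
    case True
    then have "\<not> (\<forall>k\<in>J. lam k > 0)" "\<not> (\<forall>k\<in>J. lam k < 0)" by force+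
    then show ?thesis using True by simp
  next
    case False
    obtain j where j: "j \<in> J" using ne by blast
    show ?thesis
    proof (cases "lam j > 0")
      case True
      then have "\<forall>k\<in>J. lam k > 0" using False j nz by (meson linorder_neqE_linordered_idom)
      moreover have "\<not> (\<exists>k\<in>J. lam k < 0)" "\<not> (\<forall>k\<in>J. lam k < 0)"
        using calculation j by (meson order_less_asym)+
      moreover have "?sep" using calculation by blast
      moreover have "\<exists>k\<in>J. lam k > 0" using calculation j by blast
      ultimately show ?thesis by (simp only: if_True if_False simp_thms) simp
    next
      case nl: False
      then have "lam j < 0" using nz[OF j] by simp
      then have "\<forall>k\<in>J. lam k < 0" using False j nz by (meson linorder_neqE_linordered_idom)
      moreover have "\<not> (\<exists>k\<in>J. lam k > 0)" "\<not> (\<forall>k\<in>J. lam k > 0)"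
        using calculation j by (meson order_less_asym)+
      moreover have "?sep" using calculation by blast
      moreover have "\<exists>k\<in>J. lam k < 0" using calculation j by blast
      ultimately show ?thesis by (simp only: if_True if_False simp_thms) simp
    qed
  qed
  finally show ?thesis .
qed

text \<open>
  The columns with index in \<open>I\<close> span a cone, the remaining columns a linear subspace that is
  divided out. By Cramer's rule, \<open>cone_sign m I F v\<close> is the orientation of \<open>F\<close> if \<open>v\<close> lies in the
  interior of this cone and \<open>0\<close> otherwise; \<open>hull_sign m I F b\<close> is nonzero iff the origin is an
  interior point of the simplex spanned by \<open>b\<close> and the columns in \<open>I\<close>.
\<close>

definition cone_sign :: "nat \<Rightarrow> nat set \<Rightarrow> (nat \<Rightarrow> nat \<Rightarrow> real) \<Rightarrow> (nat \<Rightarrow> real) \<Rightarrow> int" where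
  "cone_sign m I F v = (if cdet m F \<noteq> 0 \<and> (\<forall>l\<in>I. cdet m (F(l := v)) * cdet m F > 0)
     then if cdet m F > 0 then 1 else - 1 else 0)"

definition hull_sign :: "nat \<Rightarrow> nat set \<Rightarrow> (nat \<Rightarrow> nat \<Rightarrow> real) \<Rightarrow> (nat \<Rightarrow> real) \<Rightarrow> int" where
  "hull_sign m I F b = (if cdet m F < 0 \<and> (\<forall>l\<in>I. cdet m (F(l := b)) > 0) then 1 else 0) -
     (if cdet m F > 0 \<and> (\<forall>l\<in>I. cdet m (F(l := b)) < 0) then 1 else 0)"

text \<open>The ways to write \<open>v\<close> through \<open>b\<close> and the columns of
  \<open>F\<close> form a line. The part with positive coefficients at \<open>b\<close> and at
  \<open>I\<close> is an interval, and each endpoint is a facet whose cone contains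
  \<open>v\<close>. Two endpoints contribute opposite signs. A surplus arises only for a ray, that
  is, when the dependence between \<open>b\<close> and the columns has coefficients of one sign on
  \<open>b\<close> and \<open>I\<close>.\<close>

lemma sum_cone_sign_replace_column:
  assumes I: "I \<subseteq> {..<m}" and d: "cdet m F \<noteq> 0"
    and b0: "\<And>l. l \<in> I \<Longrightarrow> cdet m (F(l := b)) \<noteq> 0"
    and v0: "\<And>l. l \<in> I \<Longrightarrow> cdet m (F(l := v)) \<noteq> 0"
    and bv0: "\<And>l k. l \<in> I \<Longrightarrow> k \<in> I \<Longrightarrow> k \<noteq> l \<Longrightarrow> cdet m (F(l := b, k := v)) \<noteq> 0"
  shows "(\<Sum>l\<in>I. cone_sign m I (F(l := b)) v) - cone_sign m I F v = hull_sign m I F b"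
proof -
  let ?d = "cdet m F"
  obtain B where B: "\<And>i. i < m \<Longrightarrow> b i = (\<Sum>k<m. B k * F k i)"
    using cdet_solve[OF d, of b] by metis
  obtain M where M: "\<And>i. i < m \<Longrightarrow> v i = (\<Sum>k<m. M k * F k i)"
    using cdet_solve[OF d, of v] by metis
  have lt: "l < m" if "l \<in> I" for l using that I by auto
  have cb: "cdet m (F(l := b)) = B l * ?d" if "l \<in> I" for l
    by (rule cdet_cramer[OF B lt[OF that]])
  have cv: "cdet m (F(l := v)) = M l * ?d" if "l \<in> I" for l
    by (rule cdet_cramer[OF M lt[OF that]])
  have Bnz: "B l \<noteq> 0" if "l \<in> I" for l using b0[OF that] cb[OF that] by auto
  have Mnz: "M l \<noteq> 0" if "l \<in> I" for l using v0[OF that] cv[OF that] by auto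
  \<comment> \<open>Column \<open>l\<close> is eliminated by solving the expansion of
    \<open>b\<close> for it, which requires \<open>B l \<noteq> 0\<close>.\<close>
  have cbv: "cdet m (F(l := b, k := v)) =
      (if k = l then M l / B l else M k - M l * B k / B l) * cdet m (F(l := b))"
    if l: "l \<in> I" and k: "k \<in> I" for l k
  proof (rule cdet_cramer[where s = "\<lambda>k. if k = l then M l / B l else M k - M l * B k / B l"])
    show "k < m" using lt[OF k] .
    fix i assume i: "i < m"
    have lm: "l \<in> {..<m}" using lt[OF l] by simp
    have "b i = B l * F l i + (\<Sum>k\<in>{..<m} - {l}. B k * F k i)"
      unfolding B[OF i] by (rule sum.remove[OF _ lm]) simp
    moreover have "v i = M l * F l i + (\<Sum>k\<in>{..<m} - {l}. M k * F k i)"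
      unfolding M[OF i] by (rule sum.remove[OF _ lm]) simp
    moreover have "(\<Sum>k<m. (if k = l then M l / B l else M k - M l * B k / B l) * (F(l := b)) k i) =
       M l / B l * b i + (\<Sum>k\<in>{..<m} - {l}. (M k - M l * B k / B l) * F k i)"
      by (subst sum.remove[OF _ lm]) (auto intro!: sum.cong)
    moreover have "(\<Sum>k\<in>{..<m} - {l}. (M k - M l * B k / B l) * F k i) =
       (\<Sum>k\<in>{..<m} - {l}. M k * F k i) - M l / B l * (\<Sum>k\<in>{..<m} - {l}. B k * F k i)"
      unfolding sum_distrib_left sum_subtractf[symmetric]
      by (intro sum.cong refl) (simp add: algebra_simps)
    ultimately show "v i = (\<Sum>k<m. (if k = l then M l / B l else M k - M l * B k / B l) * (F(l := b)) k i)"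
      using Bnz[OF l] by (simp add: algebra_simps)
  qed
  \<comment> \<open>The extra index \<open>m\<close> stands for the vector \<open>b\<close> in the linear dependence
    \<open>- d b + (\<Sum>k. lam k * F k) = 0\<close>; along the line of solutions of \<open>\<Sum>k. s k * F k = v\<close>
    the coordinate \<open>s k\<close> vanishes at parameter \<open>t k\<close>.\<close>
  define lam where "lam k = (if k = m then - ?d else B k * ?d)" for k
  define t where "t k = (if k = m then 0 else M k / lam k)" for k
  let ?J = "insert m I"
  have mI: "m \<notin> I" using I by auto
  have finI: "finite I" using I finite_subset by blast
  have lnz: "lam k \<noteq> 0" if "k \<in> ?J" for k using that d Bnz by (auto simp: lam_def)
  have tI: "lam k * (t k - t l) = M k - M l * B k / B l" if "k \<in> I" "l \<in> I" for k l
    using that mI d Bnz by (auto simp: t_def lam_def field_simps)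
  have tm: "lam m * (t m - t l) = M l / B l" if "l \<in> I" for l
    using that mI d Bnz by (auto simp: t_def lam_def field_simps)
  have tm': "lam l * (t l - t m) = M l" if "l \<in> I" for l
    using that mI d Bnz by (auto simp: t_def lam_def field_simps)
  have "inj_on t ?J"
  proof (rule linorder_inj_onI')
    fix k l assume kl: "k \<in> ?J" "l \<in> ?J" "k < l"
    then have k: "k \<in> I" using I by auto
    show "t k \<noteq> t l"
    proof (cases "l = m")
      case True
      then show ?thesis using tm'[OF k] Mnz[OF k] by auto
    next
      case False
      then have l: "l \<in> I" using kl by auto
      then show ?thesis using tI[OF k l] bv0[OF l k] cbv[OF l k] kl by auto
    qed
  qed
  then have main: "(\<Sum>l\<in>?J. if \<forall>k\<in>?J - {l}. lam k * (t k - t l) > 0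
      then if lam l > 0 then 1 else - 1 else 0 :: int) =
    (if \<forall>k\<in>?J. lam k > 0 then 1 else 0) - (if \<forall>k\<in>?J. lam k < 0 then 1 else 0)"
    using finI lnz by (intro sum_sgn_separating) auto
  \<comment> \<open>Omitting index \<open>m\<close> means omitting \<open>b\<close>, so this term is
    the original facet; the minus sign comes from \<open>lam m = - ?d\<close>.\<close>
  have "(if \<forall>k\<in>?J - {m}. lam k * (t k - t m) > 0 then if lam m > 0 then 1 else - 1 else 0 :: int)
      = - cone_sign m I F v"
  proof -
    have "(\<forall>k\<in>?J - {m}. lam k * (t k - t m) > 0) \<longleftrightarrow> (\<forall>k\<in>I. M k > 0)"
      using mI tm' by auto
    also have "\<dots> \<longleftrightarrow> (\<forall>l\<in>I. cdet m (F(l := v)) * ?d > 0)"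
      using d by (intro ball_cong refl) (auto simp: cv mult.assoc zero_less_mult_iff linorder_neq_iff)
    finally show ?thesis using d by (simp add: cone_sign_def lam_def)
  qed
  moreover have "(if \<forall>k\<in>?J - {l}. lam k * (t k - t l) > 0 then if lam l > 0 then 1 else - 1 else 0 :: int)
      = cone_sign m I (F(l := b)) v" if l: "l \<in> I" for l
  proof -
    have lm: "l \<noteq> m" using l mI by auto
    have sq: "x * c * c > 0 \<longleftrightarrow> x > 0" if "c \<noteq> 0" for x c :: real
      using that by (auto simp: mult.assoc zero_less_mult_iff linorder_neq_iff)
    have "(\<forall>k\<in>?J - {l}. lam k * (t k - t l) > 0) \<longleftrightarrow>
        M l / B l > 0 \<and> (\<forall>k\<in>I - {l}. M k - M l * B k / B l > 0)"
      using lm tI[OF _ l] tm[OF l] by (auto simp: insert_Diff_if)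
    also have "\<dots> \<longleftrightarrow> (\<forall>k\<in>I. (if k = l then M l / B l else M k - M l * B k / B l) > 0)"
      using l by auto
    also have "\<dots> \<longleftrightarrow> (\<forall>k\<in>I. cdet m (F(l := b, k := v)) * cdet m (F(l := b)) > 0)"
      using l by (intro ball_cong refl) (simp only: cbv[OF l] sq[OF b0[OF l]])
    finally show ?thesis using b0[OF l] cb[OF l] lm by (simp add: cone_sign_def lam_def)
  qed
  ultimately have "(\<Sum>l\<in>?J. if \<forall>k\<in>?J - {l}. lam k * (t k - t l) > 0
      then if lam l > 0 then 1 else - 1 else 0 :: int) = - cone_sign m I F v + (\<Sum>l\<in>I. cone_sign m I (F(l := b)) v)"
    using finI mI by simp
  moreover have "(\<forall>k\<in>?J. lam k > 0) \<longleftrightarrow> cdet m F < 0 \<and> (\<forall>l\<in>I. cdet m (F(l := b)) > 0)"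
    using mI cb by (auto simp: lam_def)
  moreover have "(\<forall>k\<in>?J. lam k < 0) \<longleftrightarrow> cdet m F > 0 \<and> (\<forall>l\<in>I. cdet m (F(l := b)) < 0)"
    using mI cb by (auto simp: lam_def)
  ultimately show ?thesis using main by (simp add: hull_sign_def)
qed

subsection \<open>Separation of convex sets\<close>

text \<open>
  If \<open>u\<close> minimises the sum of the squared distances to the sets, it is the mean of its nearest
  points \<open>p c\<close>, and the vectors \<open>p c - u\<close> give the functionals.
\<close>

lemma separate_convex_compact_family:
  fixes K :: "nat \<Rightarrow> 'a::euclidean_space set"
  assumes r: "r > 0" and comp: "\<And>c. c < r \<Longrightarrow> compact (K c)" and conv: "\<And>c. c < r \<Longrightarrow> convex (K c)"
    and empty: "(\<Inter>c<r. K c) = {}"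
  obtains y :: "nat \<Rightarrow> 'a" and h :: "nat \<Rightarrow> real" where "(\<Sum>c<r. y c) = 0" "(\<Sum>c<r. h c) = 0"
    "\<And>c x. c < r \<Longrightarrow> x \<in> K c \<Longrightarrow> y c \<bullet> x + h c > 0"
proof (cases "\<exists>c<r. K c = {}")
  case True
  then obtain e where e: "e < r" "K e = {}" by blast
  \<comment> \<open>Nothing has to be positive on the empty set, so \<open>1 - real r\<close> there
    balances the constant 1 on the other sets.\<close>
  let ?h = "\<lambda>c. if c = e then 1 - real r else 1"
  have "(\<Sum>c<r. ?h c) = ?h e + (\<Sum>c\<in>{..<r} - {e}. ?h c)"
    using e by (intro sum.remove) auto
  also have "(\<Sum>c\<in>{..<r} - {e}. ?h c) = (\<Sum>c\<in>{..<r} - {e}. 1)"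
    by (intro sum.cong) auto
  finally have "(\<Sum>c<r. ?h c) = 0" using e by simp
  then show ?thesis using e by (intro that[of "\<lambda>_. 0" ?h]) auto
next
  case False
  then have ne: "\<And>c. c < r \<Longrightarrow> K c \<noteq> {}" by blast
  have cl: "\<And>c. c < r \<Longrightarrow> closed (K c)" using comp compact_imp_closed by blast
  \<comment> \<open>A compact set on which the minimum is attained and which also contains the mean
    of the nearest points, the competitor used below.\<close>
  let ?B = "convex hull (\<Union>c<r. K c)"
  have B: "compact ?B" by (intro compact_convex_hull compact_UN) (auto intro: comp)
  have "?B \<noteq> {}" using ne r by auto
  moreover have "continuous_on ?B (\<lambda>u. \<Sum>c<r. (infdist u (K c))\<^sup>2)"
    by (intro continuous_intros)
  ultimately obtain u where u: "u \<in> ?B"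
    and umin: "\<And>w. w \<in> ?B \<Longrightarrow> (\<Sum>c<r. (infdist u (K c))\<^sup>2) \<le> (\<Sum>c<r. (infdist w (K c))\<^sup>2)"
    using continuous_attains_inf[OF B, of "\<lambda>u. \<Sum>c<r. (infdist u (K c))\<^sup>2"] by blast
  define p where "p c = closest_point (K c) u" for c
  have pK: "p c \<in> K c" if "c < r" for c
    using that by (simp add: p_def closest_point_in_set cl ne)
  have pd: "infdist u (K c) = dist u (p c)" if "c < r" for c
    using that by (simp add: p_def infdist_eq_setdist setdist_closest_point cl ne)
  define w where "w = (\<Sum>c<r. (1 / real r) *\<^sub>R p c)"
  have wB: "w \<in> ?B"
    unfolding w_def
    by (rule convex_sum) (use r in \<open>auto intro!: hull_inc pK\<close>)
  have rw: "real r *\<^sub>R w = (\<Sum>c<r. p c)"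
    unfolding w_def scaleR_sum_right using r by simp
  have "(\<Sum>c<r. (dist u (p c))\<^sup>2) \<le> (\<Sum>c<r. (infdist w (K c))\<^sup>2)"
    using umin[OF wB] by (simp add: pd)
  also have "\<dots> \<le> (\<Sum>c<r. (dist w (p c))\<^sup>2)"
    by (intro sum_mono power_mono infdist_le pK) (auto simp: infdist_nonneg)
  \<comment> \<open>Expansion around the mean \<open>w\<close>: the mixed terms cancel because the
    vectors \<open>w - p c\<close> sum to 0. The chain then forces \<open>u = w\<close>.\<close>
  also have "\<dots> = (\<Sum>c<r. (dist u (p c))\<^sup>2) - real r * (norm (u - w))\<^sup>2"
  proof -
    have e: "(dist u (p c))\<^sup>2 = (dist w (p c))\<^sup>2 + (norm (u - w))\<^sup>2 + 2 * ((u - w) \<bullet> (w - p c))" for c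
      unfolding dist_norm power2_norm_eq_inner by (simp add: algebra_simps inner_commute)
    have "(\<Sum>c<r. w - p c) = 0" by (simp add: sum_subtractf rw[symmetric] scaleR_conv_of_real sum_constant_scaleR)
    then have "(\<Sum>c<r. (u - w) \<bullet> (w - p c)) = 0" by (simp add: inner_sum_right[symmetric])
    then show ?thesis by (simp add: e sum.distrib sum_distrib_left[symmetric])
  qed
  finally have "u = w" using r by (auto simp: mult_le_0_iff)
  define y where "y c = p c - u" for c
  have ysum: "(\<Sum>c<r. y c) = 0"
    using rw \<open>u = w\<close> by (simp add: y_def sum_subtractf sum_constant_scaleR)
  define S where "S = (\<Sum>c<r. (norm (y c))\<^sup>2)"
  have "S > 0"
  proof (rule ccontr)
    assume "\<not> S > 0"
    then have "S = 0" unfolding S_def by (meson linorder_not_less nle_le sum_nonneg zero_le_power2)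
    then have "\<forall>c\<in>{..<r}. (norm (y c))\<^sup>2 = 0" unfolding S_def by (subst (asm) sum_nonneg_eq_0_iff) auto
    then have "p c = u" if "c < r" for c using that by (auto simp: y_def)
    then have "u \<in> (\<Inter>c<r. K c)" using pK by force
    then show False using empty by simp
  qed
  \<comment> \<open>Chosen so that every functional takes the same positive value
    \<open>S / real r\<close> at its nearest point \<open>p c\<close>.\<close>
  define h where "h c = S / real r - y c \<bullet> u - (norm (y c))\<^sup>2" for c
  have "(\<Sum>c<r. h c) = 0"
    using r ysum by (simp add: h_def sum_subtractf S_def[symmetric] inner_sum_left[symmetric])
  moreover have "y c \<bullet> x + h c > 0" if c: "c < r" and x: "x \<in> K c" for c x
  proof -
    have "(u - p c) \<bullet> (x - p c) \<le> 0"
      unfolding p_def by (rule closest_point_dot[OF conv[OF c] cl[OF c] x])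
    then have "y c \<bullet> (x - u) \<ge> (norm (y c))\<^sup>2"
      unfolding y_def power2_norm_eq_inner by (simp add: algebra_simps inner_commute)
    moreover have "S / real r > 0" using \<open>S > 0\<close> r by simp
    ultimately show ?thesis by (simp add: h_def inner_diff_right)
  qed
  ultimately show ?thesis using ysum that by blast
qed

subsection \<open>Generic perturbation\<close>

text \<open>Being polynomial along every line is all that the perturbation argument uses, and it
  avoids multivariate polynomials.\<close>

definition line_poly :: "((nat \<Rightarrow> nat \<Rightarrow> real) \<Rightarrow> real) \<Rightarrow> bool" where
  "line_poly P \<longleftrightarrow> (\<forall>z y. \<exists>p. \<forall>t. P (\<lambda>k i. z k i + t * (y k i - z k i)) = poly p t)"

lemma line_polyD:
  "line_poly P \<Longrightarrow> \<exists>p. \<forall>t. P (\<lambda>k i. z k i + t * (y k i - z k i)) = poly p t"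
  unfolding line_poly_def by blast

lemma line_poly_const: "line_poly (\<lambda>z. c)"
  unfolding line_poly_def by (auto intro!: exI[of _ "[:c:]"])

lemma line_poly_coord: "line_poly (\<lambda>z. z k i)"
  unfolding line_poly_def
proof (intro allI)
  fix z y :: "nat \<Rightarrow> nat \<Rightarrow> real"
  show "\<exists>p. \<forall>t. z k i + t * (y k i - z k i) = poly p t"
    by (intro exI[of _ "[:z k i, y k i - z k i:]"]) simp
qed

lemma line_poly_mult:
  assumes "line_poly P" "line_poly Q"
  shows "line_poly (\<lambda>z. P z * Q z)"
  unfolding line_poly_def
proof (intro allI)
  fix z y :: "nat \<Rightarrow> nat \<Rightarrow> real"
  obtain p q where "\<forall>t. P (\<lambda>k i. z k i + t * (y k i - z k i)) = poly p t"
    "\<forall>t. Q (\<lambda>k i. z k i + t * (y k i - z k i)) = poly q t"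
    using assms unfolding line_poly_def by blast
  then show "\<exists>p. \<forall>t. P (\<lambda>k i. z k i + t * (y k i - z k i)) * Q (\<lambda>k i. z k i + t * (y k i - z k i)) = poly p t"
    by (intro exI[of _ "p * q"]) simp
qed

lemma line_poly_sum:
  assumes "\<And>a. a \<in> A \<Longrightarrow> line_poly (P a)"
  shows "line_poly (\<lambda>z. \<Sum>a\<in>A. P a z)"
  unfolding line_poly_def
proof (intro allI)
  fix z y :: "nat \<Rightarrow> nat \<Rightarrow> real"
  have "\<forall>a\<in>A. \<exists>p. \<forall>t. P a (\<lambda>k i. z k i + t * (y k i - z k i)) = poly p t"
    using assms unfolding line_poly_def by blast
  then obtain p where "\<forall>a\<in>A. \<forall>t. P a (\<lambda>k i. z k i + t * (y k i - z k i)) = poly (p a) t"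
    by (rule bchoice[THEN exE])
  then show "\<exists>p. \<forall>t. (\<Sum>a\<in>A. P a (\<lambda>k i. z k i + t * (y k i - z k i))) = poly p t"
    by (intro exI[of _ "\<Sum>a\<in>A. p a"]) (simp add: poly_sum)
qed

lemma line_poly_cdet:
  assumes "\<And>k i. line_poly (\<lambda>z. F z k i)"
  shows "line_poly (\<lambda>z. cdet m (F z))"
  unfolding line_poly_def
proof (intro allI)
  fix z y :: "nat \<Rightarrow> nat \<Rightarrow> real"
  show "\<exists>p. \<forall>t. cdet m (F (\<lambda>k i. z k i + t * (y k i - z k i))) = poly p t"
    by (rule cdet_poly) (use assms in \<open>unfold line_poly_def, blast\<close>)
qed

text \<open>One function at a time: a short move from a good \<open>z\<close> towards a point where
  the new function is nonzero keeps the finitely many open conditions, and the new function has only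
  finitely many zeros on that line.\<close>

lemma generic_perturbation:
  assumes "finite \<P>" "finite \<Q>"
    and P: "\<And>P. P \<in> \<P> \<Longrightarrow> line_poly P \<and> (\<exists>y. P y \<noteq> 0)"
    and Q: "\<And>Q. Q \<in> \<Q> \<Longrightarrow> line_poly Q \<and> Q z0 > 0"
  shows "\<exists>z. (\<forall>P\<in>\<P>. P z \<noteq> 0) \<and> (\<forall>Q\<in>\<Q>. Q z > 0)"
  using \<open>finite \<P>\<close> P
proof (induction \<P>)
  case empty
  then show ?case using Q by auto
next
  case (insert P0 \<P>)
  then obtain z where z: "\<forall>P\<in>\<P>. P z \<noteq> 0" "\<forall>Q\<in>\<Q>. Q z > 0" by auto
  obtain y where y: "P0 y \<noteq> 0" using insert.prems by auto
  define w where "w t = (\<lambda>k i. z k i + t * (y k i - z k i))" for t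
  have w0: "w 0 = z" and w1: "w 1 = y" by (auto simp: w_def)
  have lim: "((\<lambda>t. P (w t)) \<longlongrightarrow> P z) (at 0)" if lp: "line_poly P" for P
  proof -
    obtain p where p: "\<And>t. P (w t) = poly p t" 
      using line_polyD[OF lp, of z y] unfolding w_def by blast
    have "(poly p \<longlongrightarrow> poly p 0) (at 0)"
      using isCont_def by (metis poly_isCont)
    then show ?thesis using p[of 0] by (simp add: p w0)
  qed
  have "\<forall>\<^sub>F t in at 0. \<forall>P\<in>\<P>. P (w t) \<noteq> 0"
    using insert.prems z insert.hyps
    by (intro eventually_ball_finite ballI tendsto_imp_eventually_ne[OF lim]) auto
  moreover have "\<forall>\<^sub>F t in at 0. \<forall>Q\<in>\<Q>. Q (w t) > 0"
    using Q z \<open>finite \<Q>\<close>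
    by (intro eventually_ball_finite ballI order_tendstoD(1)[OF lim]) auto
  moreover have "\<forall>\<^sub>F t in at 0. P0 (w t) \<noteq> 0"
  proof -
    obtain p where p: "\<And>t. P0 (w t) = poly p t"
      using line_polyD[of P0 z y] insert.prems unfolding w_def by blast
    have "p \<noteq> 0" using p[of 1] y by (auto simp: w1)
    then have "finite {t. poly p t = 0}" by (rule poly_roots_finite)
    then have "\<forall>\<^sub>F t in at 0. t \<notin> {t. poly p t = 0}"
      using islimpt_finite islimpt_iff_eventually by blast
    then show ?thesis by (simp add: p)
  qed
  ultimately have "\<forall>\<^sub>F t in at 0. (\<forall>P\<in>insert P0 \<P>. P (w t) \<noteq> 0) \<and> (\<forall>Q\<in>\<Q>. Q (w t) > 0)"
    by eventually_elim auto
  moreover have "at (0::real) \<noteq> bot" by simp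
  ultimately show ?case using eventually_happens by blast
qed

subsection \<open>The degree of the rainbow complex\<close>

locale color_grid =
  fixes n r :: nat
  assumes n: "n > 0" and r: "r > 1"
begin

text \<open>
  An index \<open>k < n * r\<close> encodes the pair \<open>(k div r, k mod r)\<close>. As a coordinate, \<open>(j, c)\<close> is the
  \<open>j\<close>-th homogeneous coordinate in the copy of \<open>\<real>\<^sup>n\<close> belonging to color \<open>c\<close>. As a
  column, \<open>(j, i)\<close> with \<open>i > 0\<close> is the \<open>i\<close>-th point of class \<open>j\<close>, while \<open>(j, 0)\<close> is
  a dummy slot: it carries the \<open>j\<close>-th diagonal vector, so that all determinants are those of the
  quotient of \<open>(\<real>\<^sup>n)\<^sup>r\<close> by the diagonal. A permutation \<open>q\<close> in \<open>G\<close> gives the point \<open>k\<close>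
  the color \<open>q k mod r\<close>; the slot of a class receives the color that the class does not use. In the
  quotient, \<open>v\<close> is the negative of the diagonal vector in color \<open>0\<close>.
\<close>

definition m where "m = n * r"
definition I where "I = {k. k < m \<and> k mod r \<noteq> 0}"
definition G where "G = {q. q permutes {..<m} \<and> (\<forall>k. q k div r = k div r)}"
definition v :: "nat \<Rightarrow> real" where "v i = (if i mod r = 0 then 0 else 1)"
definition diag :: "nat \<Rightarrow> nat \<Rightarrow> real" where "diag k i = (if i div r = k div r then 1 else 0)"
text \<open>\<open>(j, c)\<close> goes to \<open>(j, c - e)\<close>, colors modulo \<open>r\<close>,
  so off the slots \<open>cols\<close> rotates \<open>x k\<close> by \<open>e k\<close> colors. A
  lifted point has entries in color 0 only, but \<open>x k\<close> may be any vector of all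
  \<open>m\<close> coordinates; perturbations take place in this larger space.\<close>

definition unshift where "unshift e i = i div r * r + (i mod r + (r - e)) mod r"
definition cols :: "(nat \<Rightarrow> nat \<Rightarrow> real) \<Rightarrow> (nat \<Rightarrow> nat) \<Rightarrow> nat \<Rightarrow> nat \<Rightarrow> real" where
  "cols x e k = (if k mod r = 0 then diag k else (\<lambda>i. x k (unshift (e k) i)))"
abbreviation facet where "facet x q \<equiv> cols x (\<lambda>k. q k mod r)"
definition deg where "deg x = (\<Sum>q\<in>G. sign q * cone_sign m I (facet x q) v)"
abbreviation swap_slot where "swap_slot l \<equiv> Transposition.transpose l (l div r * r)"
definition cyc where "cyc i = (if i < m then i div r * r + (i mod r + 1) mod r else i)"

section \<open>Arithmetic of indices and colors\<close>

lemma less_m_iff: "k < m \<longleftrightarrow> k div r < n"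
  using r by (simp add: m_def div_less_iff_less_mult)

lemma I_sub: "I \<subseteq> {..<m}" and I_fin: "finite I"
  by (auto simp: I_def)

lemma nat_eq_div_mod: "x div r = y div r \<Longrightarrow> x mod r = y mod r \<Longrightarrow> x = y"
  by (metis div_mult_mod_eq)

lemma block_div: "c < r \<Longrightarrow> (k * r + c) div r = k" and block_mod: "c < r \<Longrightarrow> (k * r + c) mod r = c"
  by auto

lemma add_mod_cases: "a < r \<Longrightarrow> s \<le> r \<Longrightarrow> (a + s) mod r = (if a + s < r then a + s else a + s - r)"
  using r by (simp add: le_mod_geq)

lemma add_mod_cancel:
  assumes "a < r" "b < r" "s \<le> r" "(a + s) mod r = (b + s) mod r"
  shows "a = b"
  using assms by (auto simp: add_mod_cases split: if_splits)

lemma unshift_div: "unshift e i div r = i div r"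
  and unshift_mod: "unshift e i mod r = (i mod r + (r - e)) mod r"
  using r by (auto simp: unshift_def)

lemma unshift_inj: "unshift e i = unshift e k \<Longrightarrow> i = k"
proof (rule nat_eq_div_mod)
  assume eq: "unshift e i = unshift e k"
  show "i div r = k div r" using eq unshift_div by metis
  have eqm: "(i mod r + (r - e)) mod r = (k mod r + (r - e)) mod r" using eq unshift_mod by metis
  show "i mod r = k mod r" by (rule add_mod_cancel[OF _ _ _ eqm]) (use r in simp_all)
qed

lemma cyc_div: "cyc i div r = i div r"
  using r by (auto simp: cyc_def)

lemma cyc_mod: "i < m \<Longrightarrow> cyc i mod r = (i mod r + 1) mod r"
  using r by (auto simp: cyc_def)

lemma mod_succ_cases: "a < r \<Longrightarrow> Suc a mod r = (if Suc a = r then 0 else Suc a)"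
  using r by auto

lemma cyc_lt: "i < m \<Longrightarrow> cyc i < m"
  using cyc_div by (simp add: less_m_iff)

lemma cyc_permutes: "cyc permutes {..<m}"
proof (rule inj_imp_permutes)
  show "inj_on cyc {..<m}"
  proof (rule inj_onI)
    fix x y assume xy: "x \<in> {..<m}" "y \<in> {..<m}" "cyc x = cyc y"
    show "x = y"
    proof (rule nat_eq_div_mod)
      show "x div r = y div r" using xy cyc_div by metis
      have eqm: "(x mod r + 1) mod r = (y mod r + 1) mod r" using xy cyc_mod by (metis lessThan_iff)
      show "x mod r = y mod r" by (rule add_mod_cancel[OF _ _ _ eqm]) (use r in simp_all)
    qed
  qed
qed (auto simp: cyc_lt, simp add: cyc_def)

text \<open>Rotating color and coordinate together leaves their difference modulo \<open>r\<close>
  unchanged; the cases treat the wrap-arounds.\<close>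

lemma unshift_cyc:
  assumes e: "e < r" and i: "i < m"
  shows "unshift ((e + 1) mod r) (cyc i) = unshift e i"
proof (rule nat_eq_div_mod)
  show "unshift ((e + 1) mod r) (cyc i) div r = unshift e i div r" by (simp add: unshift_div cyc_div)
  define a where "a = i mod r"
  have a: "a < r" using r by (simp add: a_def)
  have "((a + 1) mod r + (r - (e + 1) mod r)) mod r = (a + (r - e)) mod r"
  proof (cases "a + 1 = r")
    case True
    then have "a + (r - e) = r - (e + 1) + r" using e by simp
    then have "(a + (r - e)) mod r = (r - (e + 1)) mod r" by simp
    then show ?thesis using True e r by (cases "Suc e = r") (simp_all add: mod_succ_cases)
  next
    case False
    then have s: "Suc a < r" using a by simp
    show ?thesis
    proof (cases "Suc e = r")
      case True
      then have e1: "(e + 1) mod r = 0" "r - e = 1" by auto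
      have "(Suc a + r) mod r = Suc a mod r" by (rule mod_add_self2)
      then show ?thesis unfolding e1 using s by simp
    next
      case False
      then have "Suc a + (r - Suc e) = a + (r - e)" "Suc e < r" using e by auto
      then show ?thesis using s by simp
    qed
  qed
  then show "unshift ((e + 1) mod r) (cyc i) mod r = unshift e i mod r"
    using i by (simp only: unshift_mod cyc_mod a_def)
qed

section \<open>Color permutations within the classes and their cyclic symmetry\<close>

lemma G_perm: "q \<in> G \<Longrightarrow> q permutes {..<m}" and G_div: "q \<in> G \<Longrightarrow> q k div r = k div r"
  by (auto simp: G_def)

lemma G_lt: "q \<in> G \<Longrightarrow> k < m \<Longrightarrow> q k < m"
  by (simp add: less_m_iff G_div)

lemma G_inj: "q \<in> G \<Longrightarrow> q a = q b \<Longrightarrow> a = b"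
  using G_perm permutes_inj by (metis injD)

lemma G_finite: "finite G"
  by (rule finite_subset[OF _ finite_permutations[of "{..<m}"]]) (auto simp: G_def)

lemma G_compose: "p \<in> G \<Longrightarrow> q \<in> G \<Longrightarrow> p \<circ> q \<in> G"
  by (auto simp: G_def permutes_compose)

lemma G_inv:
  assumes "q \<in> G" shows "inv_into UNIV q \<in> G"
proof -
  have "inv_into UNIV q k div r = k div r" for k
    using G_div[OF assms, of "inv_into UNIV q k"] permutes_inverses(1)[OF G_perm[OF assms], of k] by simp
  then show ?thesis using permutes_inv[OF G_perm[OF assms]] by (simp add: G_def)
qed

lemma G_sign_compose: "p \<in> G \<Longrightarrow> q \<in> G \<Longrightarrow> sign (p \<circ> q) = sign p * sign q"
  by (intro sign_compose) (auto intro: permutes_imp_permutation G_perm)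

lemma cyc_G: "cyc \<in> G"
  by (simp add: G_def cyc_permutes cyc_div)

lemma slot_lt: "l < m \<Longrightarrow> l div r * r < m"
  by (meson div_times_less_eq_dividend le_less_trans)

lemma slot_notin_I: "l div r * r \<notin> I"
  by (simp add: I_def)

lemma swap_G:
  assumes "l < m" shows "swap_slot l \<in> G"
proof -
  have "swap_slot l k div r = k div r" for k
    using r by (auto simp: Transposition.transpose_def)
  moreover have "swap_slot l permutes {..<m}"
    by (rule permutes_swap_id) (use assms slot_lt in auto)
  ultimately show ?thesis by (simp add: G_def)
qed

lemma sign_swap: "l \<in> I \<Longrightarrow> sign (swap_slot l) = - 1"
  by (metis slot_notin_I sign_swap_id)

text \<open>Shifting all colors only rotates the rows, since diagonal vectors are constant on
  blocks.\<close>

lemma facet_cyc: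
  assumes "q \<in> G" "k < m" "i < m"
  shows "facet x (cyc \<circ> q) k (cyc i) = facet x q k i"
  using unshift_cyc[of "q k mod r" i] assms r
  by (simp add: cols_def diag_def cyc_div cyc_mod[OF G_lt])

lemma cdet_cyc:
  assumes "\<And>k i. k < m \<Longrightarrow> i < m \<Longrightarrow> F' k (cyc i) = F k i"
  shows "cdet m F = sign cyc * cdet m F'"
proof -
  have "cdet m F = cdet m (\<lambda>k i. F' k (cyc i))"
    by (rule cdet_cong) (simp add: assms)
  then show ?thesis using cdet_permute_rows[OF cyc_permutes] by simp
qed

text \<open>All determinants change by the same sign; if it is negative, the two summands of
  \<open>hull_sign\<close> trade places.\<close>

lemma hull_sign_cyc:
  assumes F: "\<And>k i. k < m \<Longrightarrow> i < m \<Longrightarrow> F' k (cyc i) = F k i"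
    and b: "\<And>i. i < m \<Longrightarrow> b' (cyc i) = b i"
  shows "hull_sign m I F b = sign cyc * hull_sign m I F' b'"
proof -
  have 1: "cdet m F = sign cyc * cdet m F'" by (rule cdet_cyc) (rule F)
  have 2: "cdet m (F(l := b)) = sign cyc * cdet m (F'(l := b'))" for l
    by (rule cdet_cyc) (auto simp: F b)
  have "sign cyc = 1 \<or> sign cyc = - 1" by (simp add: sign_def)
  then show ?thesis by (elim disjE) (simp_all add: hull_sign_def 1 2)
qed

text \<open>Composition with \<open>cyc\<close> permutes the classes \<open>{q \<in> G. q 0 = a}\<close>, \<open>a < r\<close>, cyclically.\<close>

lemma dvd_sum_cyc_invariant:
  fixes h :: "(nat \<Rightarrow> nat) \<Rightarrow> int"
  assumes h: "\<And>q. q \<in> G \<Longrightarrow> h (cyc \<circ> q) = h q"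
  shows "int r dvd (\<Sum>q\<in>G. h q)"
proof -
  let ?S = "\<lambda>a. \<Sum>q | q \<in> G \<and> q 0 = a. h q"
  have m0: "r \<le> m" using n by (simp add: m_def)
  have step: "?S (Suc a) = ?S a" if a: "Suc a < r" for a
  proof (rule sum.reindex_bij_witness[where i = "\<lambda>q. cyc \<circ> q" and j = "\<lambda>q. inv_into UNIV cyc \<circ> q"])
    have am: "cyc a = Suc a" using a m0 by (simp add: cyc_def)
    have ia: "inv_into UNIV cyc (Suc a) = a"
      using am permutes_inverses(2)[OF cyc_permutes, of a] by simp
    have c1: "cyc \<circ> inv_into UNIV cyc = id" and c2: "inv_into UNIV cyc \<circ> cyc = id"
      using permutes_inv_o[OF cyc_permutes] by auto
    fix q assume q: "q \<in> {q. q \<in> G \<and> q 0 = Suc a}"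
    show "cyc \<circ> (inv_into UNIV cyc \<circ> q) = q" by (simp add: o_assoc c1)
    show "inv_into UNIV cyc \<circ> q \<in> {q. q \<in> G \<and> q 0 = a}"
      using q ia G_compose[OF G_inv[OF cyc_G]] by auto
    show "h (inv_into UNIV cyc \<circ> q) = h q"
      using h[of "inv_into UNIV cyc \<circ> q"] q G_compose[OF G_inv[OF cyc_G]] by (simp add: o_assoc c1)
  next
    have am: "cyc a = Suc a" using a m0 by (simp add: cyc_def)
    have c2: "inv_into UNIV cyc \<circ> cyc = id"
      using permutes_inv_o[OF cyc_permutes] by auto
    fix q assume q: "q \<in> {q. q \<in> G \<and> q 0 = a}"
    show "inv_into UNIV cyc \<circ> (cyc \<circ> q) = q" by (simp add: o_assoc c2)
    show "cyc \<circ> q \<in> {q. q \<in> G \<and> q 0 = Suc a}"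
      using q am G_compose[OF cyc_G] by auto
  qed
  have eq: "a < r \<Longrightarrow> ?S a = ?S 0" for a
  proof (induction a)
    case (Suc a)
    then show ?case using step[of a] by simp
  qed simp
  have "(\<Sum>a<r. ?S a) = (\<Sum>a<r. ?S 0)" by (rule sum.cong[OF refl], rule eq) simp
  moreover have "(\<Sum>a<r. ?S a) = (\<Sum>q\<in>G. h q)"
  proof (rule sum.group[OF G_finite])
    show "(\<lambda>q. q 0) ` G \<subseteq> {..<r}"
      using G_div[of _ 0] r by (auto simp: div_eq_0_iff)
  qed simp
  ultimately have "(\<Sum>q\<in>G. h q) = int r * ?S 0" by simp
  then show ?thesis by (simp only: dvd_triv_left)
qed

lemma sum_swap_cancel:
  fixes h :: "(nat \<Rightarrow> nat) \<Rightarrow> int"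
  assumes l: "l \<in> I" and h: "\<And>q. q \<in> G \<Longrightarrow> h (q \<circ> swap_slot l) = - h q"
  shows "(\<Sum>q\<in>G. h q) = 0"
proof -
  let ?u = "swap_slot l"
  have u: "?u \<in> G" using l by (intro swap_G) (simp add: I_def)
  have "(\<Sum>q\<in>G. h q) = (\<Sum>q\<in>G. h (q \<circ> ?u))"
    by (rule sum.reindex_bij_witness[where i = "\<lambda>q. q \<circ> ?u" and j = "\<lambda>q. q \<circ> ?u"])
      (simp_all add: comp_assoc G_compose[OF _ u])
  also have "\<dots> = - (\<Sum>q\<in>G. h q)" by (simp add: h sum_negf)
  finally show ?thesis by simp
qed

text \<open>
  Replacing column \<open>l \<noteq> t\<close> by the new position of the point \<open>t\<close> forgets the color of \<open>l\<close>, and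
  the two ways to color \<open>l\<close> have opposite signs. Hence only the \<open>hull_sign\<close> terms survive, and these
  are invariant under the cyclic shift of the colors because they do not depend on \<open>v\<close>.
\<close>

lemma deg_replace_point:
  assumes t: "t \<in> I"
    and d: "\<And>q. q \<in> G \<Longrightarrow> cdet m (facet x q) \<noteq> 0"
    and db: "\<And>q l. q \<in> G \<Longrightarrow> l \<in> I \<Longrightarrow> cdet m ((facet x q)(l := \<lambda>i. b (unshift (q t mod r) i))) \<noteq> 0"
    and dv: "\<And>q l. q \<in> G \<Longrightarrow> l \<in> I \<Longrightarrow> cdet m ((facet x q)(l := v)) \<noteq> 0"
    and dbv: "\<And>q l k. q \<in> G \<Longrightarrow> l \<in> I \<Longrightarrow> k \<in> I \<Longrightarrow> k \<noteq> l \<Longrightarrow>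
      cdet m ((facet x q)(l := \<lambda>i. b (unshift (q t mod r) i), k := v)) \<noteq> 0"
  shows "int r dvd deg (x(t := b)) - deg x"
proof -
  define B where "B q = (\<lambda>i. b (unshift (q t mod r) i))" for q :: "nat \<Rightarrow> nat"
  have t0: "t mod r \<noteq> 0" and tm: "t < m" using t by (auto simp: I_def)
  have Dt: "deg (x(t := b)) = (\<Sum>q\<in>G. sign q * cone_sign m I ((facet x q)(t := B q)) v)"
    unfolding deg_def
  proof (intro sum.cong refl)
    fix q
    have "facet (x(t := b)) q = (facet x q)(t := B q)" 
    proof
      fix k
      show "facet (x(t := b)) q k = ((facet x q)(t := B q)) k"
        using t0 by (cases "k = t") (simp_all add: cols_def B_def)
    qed
    then show "sign q * cone_sign m I (facet (x(t := b)) q) v = sign q * cone_sign m I ((facet x q)(t := B q)) v" by simp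
  qed
  have zero: "(\<Sum>q\<in>G. sign q * cone_sign m I ((facet x q)(l := B q)) v) = 0" if l: "l \<in> I - {t}" for l
  proof (rule sum_swap_cancel[of l])
    let ?u = "swap_slot l"
    show lI: "l \<in> I" using l by simp
    fix q assume q: "q \<in> G"
    have ut: "?u t = t" using l slot_notin_I[of l] t by (intro transpose_apply_other) auto
    have "(facet x (q \<circ> ?u))(l := B (q \<circ> ?u)) = (facet x q)(l := B q)"
    proof
      fix k
      have "?u k = k" if "k \<noteq> l" "k mod r \<noteq> 0"
      proof (rule transpose_apply_other)
        show "k \<noteq> l div r * r" using that by (metis mod_mult_self2_is_0)
      qed (use that in simp)
      then show "((facet x (q \<circ> ?u))(l := B (q \<circ> ?u))) k = ((facet x q)(l := B q)) k"
        by (cases "k = l"; cases "k mod r = 0") (simp_all add: cols_def B_def ut)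
    qed
    moreover have "sign (q \<circ> ?u) = - sign q"
      using G_sign_compose[OF q swap_G] sign_swap[OF lI] lI I_sub by auto
    ultimately show "sign (q \<circ> ?u) * cone_sign m I ((facet x (q \<circ> ?u))(l := B (q \<circ> ?u))) v =
        - (sign q * cone_sign m I ((facet x q)(l := B q)) v)" by simp
  qed
  have "(\<Sum>q\<in>G. sign q * hull_sign m I (facet x q) (B q)) =
      (\<Sum>q\<in>G. sign q * ((\<Sum>l\<in>I. cone_sign m I ((facet x q)(l := B q)) v) - cone_sign m I (facet x q) v))"
    using d db dv dbv
    by (intro sum.cong refl arg_cong2[where f = "(*)"] sum_cone_sign_replace_column[symmetric] I_sub)
      (auto simp: B_def)
  also have "\<dots> = (\<Sum>l\<in>I. \<Sum>q\<in>G. sign q * cone_sign m I ((facet x q)(l := B q)) v) - deg x"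
    by (simp add: deg_def right_diff_distrib sum_subtractf sum_distrib_left sum.swap[of _ I])
  also have "(\<Sum>l\<in>I. \<Sum>q\<in>G. sign q * cone_sign m I ((facet x q)(l := B q)) v) = deg (x(t := b))"
    using zero by (subst sum.remove[OF I_fin t]) (simp add: Dt)
  finally have "deg (x(t := b)) - deg x = (\<Sum>q\<in>G. sign q * hull_sign m I (facet x q) (B q))" by simp
  moreover have "int r dvd (\<Sum>q\<in>G. sign q * hull_sign m I (facet x q) (B q))"
  proof (rule dvd_sum_cyc_invariant)
    fix q assume q: "q \<in> G"
    have "hull_sign m I (facet x q) (B q) = sign cyc * hull_sign m I (facet x (cyc \<circ> q)) (B (cyc \<circ> q))"
    proof (rule hull_sign_cyc)
      show "\<And>k i. k < m \<Longrightarrow> i < m \<Longrightarrow> facet x (cyc \<circ> q) k (cyc i) = facet x q k i"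
        by (rule facet_cyc[OF q])
      show "\<And>i. i < m \<Longrightarrow> B (cyc \<circ> q) (cyc i) = B q i"
        using unshift_cyc[of "q t mod r"] r by (simp add: B_def cyc_mod[OF G_lt[OF q tm]])
    qed
    \<comment> \<open>This sign cancels the one produced by rotating the rows.\<close>
    moreover have "sign (cyc \<circ> q) = sign cyc * sign q" by (rule G_sign_compose[OF cyc_G q])
    ultimately show "sign (cyc \<circ> q) * hull_sign m I (facet x (cyc \<circ> q)) (B (cyc \<circ> q)) =
        sign q * hull_sign m I (facet x q) (B q)" by (simp add: mult_ac)
  qed
  ultimately show ?thesis by simp
qed

lemma cone_sign_cong:
  assumes "\<And>k i. k < m \<Longrightarrow> i < m \<Longrightarrow> F k i = F' k i"
  shows "cone_sign m I F w = cone_sign m I F' w"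
proof -
  have "cdet m F = cdet m F'" by (rule cdet_cong) (rule assms)
  moreover have "cdet m (F(l := w)) = cdet m (F'(l := w))" for l
    by (rule cdet_cong) (simp add: assms)
  ultimately show ?thesis by (simp add: cone_sign_def)
qed

lemma deg_cong:
  assumes "\<And>k. k \<in> I \<Longrightarrow> x k = x' k"
  shows "deg x = deg x'"
  unfolding deg_def
proof (intro sum.cong refl arg_cong2[where f = "(*)"] cone_sign_cong)
  fix q k i assume "k < m" "i < m"
  then show "facet x q k i = facet x' q k i" using assms[of k] by (simp add: cols_def I_def)
qed

section \<open>A unimodular column family and general position\<close>

lemma slot_eqI: "l div r = k div r \<Longrightarrow> l mod r = 0 \<Longrightarrow> l = k div r * r"
  by (metis add.right_neutral div_mult_mod_eq)

text \<open>This family is lower triangular with unit diagonal. It witnesses that the determinants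
  in question do not vanish identically, and up to a row permutation it is every facet of the
  reference configuration.\<close>

definition base :: "nat \<Rightarrow> nat \<Rightarrow> real" where
  "base k = (if k mod r = 0 then diag k else (\<lambda>i. if i = k then 1 else 0))"

lemma base_altdef:
  "base k i = (if k = i then if i mod r = 0 then 0 else 1 else 0) + (if k = i div r * r then 1 else 0)"
proof (cases "k mod r = 0")
  case True
  then have k: "k div r * r = k" by auto
  then have "i div r = k div r \<longleftrightarrow> k = i div r * r" using r by (metis block_div)
  moreover have "k = i \<Longrightarrow> i mod r = 0" using True by simp
  ultimately show ?thesis using True by (simp add: base_def diag_def)
next
  case False
  then have "k \<noteq> i div r * r" by (metis mod_mult_self2_is_0)
  then show ?thesis using False by (auto simp: base_def)
qed

lemma sum_base:
  assumes "i < m"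
  shows "(\<Sum>k<m. s k * base k i) = (if i mod r = 0 then s i else s i + s (i div r * r))"
proof -
  have "(\<Sum>k<m. s k * base k i) = (\<Sum>k<m. (if k = i then if i mod r = 0 then 0 else s i else 0) +
      (if k = i div r * r then s k else 0))"
    by (intro sum.cong refl) (auto simp: base_altdef)
  also have "\<dots> = (if i mod r = 0 then 0 else s i) + s (i div r * r)"
    using assms slot_lt[OF assms] by (simp add: sum.distrib)
  also have "\<dots> = (if i mod r = 0 then s i else s i + s (i div r * r))"
    by auto
  finally show ?thesis .
qed

lemma cdet_base: "cdet m base = 1"
proof (rule cdet_lower_triangular)
  fix i k :: nat assume ik: "i < k"
  have "k \<noteq> i div r * r" using ik div_times_less_eq_dividend[of i r] by linarith
  then show "base k i = 0" using ik by (simp add: base_altdef)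
qed (simp add: base_def diag_def)

text \<open>The slot column carries the diagonal vector, so reading \<open>w\<close> modulo the
  diagonal subtracts its slot coordinate.\<close>

lemma cdet_base_replace:
  assumes "l \<in> I"
  shows "cdet m (base(l := w)) = w l - w (l div r * r)"
proof -
  define s where "s k = (if k mod r = 0 then w k else w k - w (k div r * r))" for k
  have "cdet m (base(l := w)) = s l * cdet m base"
  proof (rule cdet_cramer)
    fix i assume "i < m"
    then show "w i = (\<Sum>k<m. s k * base k i)" by (subst sum_base) (auto simp: s_def)
  qed (use assms in \<open>simp add: I_def\<close>)
  then show ?thesis using assms by (simp add: cdet_base s_def I_def)
qed

lemma v_slot: "v (k div r * r) = 0" and v_I: "k \<in> I \<Longrightarrow> v k = 1"
  by (simp_all add: v_def I_def)

text \<open>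
  A configuration \<open>z\<close> holds the initial positions of the points at the indices below \<open>m\<close> and the
  final ones at \<open>m + k\<close>.
\<close>

definition gen_pos where
  "gen_pos z \<longleftrightarrow> (\<forall>f\<in>{..<m} \<rightarrow>\<^sub>E {..<2 * m}. \<forall>e\<in>{..<m} \<rightarrow>\<^sub>E {..<r}. inj_on f {..<m} \<longrightarrow>
     cdet m (cols (\<lambda>k. z (f k)) e) \<noteq> 0 \<and> (\<forall>l\<in>I. cdet m ((cols (\<lambda>k. z (f k)) e)(l := v)) \<noteq> 0))"

text \<open>Extensional \<open>f\<close> and \<open>e\<close> make \<open>gen_pos\<close> a finite
  conjunction; determinants see only columns below \<open>m\<close>, so restriction changes
  nothing.\<close>

lemma gen_posD:
  assumes z: "gen_pos z" and f: "f \<in> {..<m} \<rightarrow> {..<2 * m}" and e: "e \<in> {..<m} \<rightarrow> {..<r}"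
    and inj: "inj_on f {..<m}"
  shows "cdet m (cols (\<lambda>k. z (f k)) e) \<noteq> 0"
    and "l \<in> I \<Longrightarrow> cdet m ((cols (\<lambda>k. z (f k)) e)(l := v)) \<noteq> 0"
proof -
  let ?f = "restrict f {..<m}" and ?e = "restrict e {..<m}"
  have "inj_on ?f {..<m}" using inj by (simp add: inj_on_def)
  moreover have "?f \<in> {..<m} \<rightarrow>\<^sub>E {..<2 * m}" "?e \<in> {..<m} \<rightarrow>\<^sub>E {..<r}" using f e by auto
  ultimately have *: "cdet m (cols (\<lambda>k. z (?f k)) ?e) \<noteq> 0"
    "\<forall>l\<in>I. cdet m ((cols (\<lambda>k. z (?f k)) ?e)(l := v)) \<noteq> 0"
    using z unfolding gen_pos_def by blast+
  have "cdet m (cols (\<lambda>k. z (f k)) e) = cdet m (cols (\<lambda>k. z (?f k)) ?e)"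
    by (rule cdet_cong) (simp add: cols_def)
  then show "cdet m (cols (\<lambda>k. z (f k)) e) \<noteq> 0" using * by simp
  have "cdet m ((cols (\<lambda>k. z (f k)) e)(l := v)) = cdet m ((cols (\<lambda>k. z (?f k)) ?e)(l := v))"
    by (rule cdet_cong) (simp add: cols_def)
  then show "l \<in> I \<Longrightarrow> cdet m ((cols (\<lambda>k. z (f k)) e)(l := v)) \<noteq> 0" using * by simp
qed

text \<open>Injectivity of \<open>f\<close> lets the columns off the slots be prescribed
  independently: column \<open>k\<close> uses the unit vector that rotation by \<open>e k\<close>
  carries to position \<open>k\<close>.\<close>

lemma cols_eq_base_exists:
  fixes f :: "nat \<Rightarrow> nat"
  assumes inj: "inj_on f {..<m}"
  obtains y where "\<And>k. k < m \<Longrightarrow> cols (\<lambda>k. y (f k)) e k = base k"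
proof -
  define y :: "nat \<Rightarrow> nat \<Rightarrow> real" where
    "y j = (\<lambda>i. if i = (let k = inv_into {..<m} f j in unshift (e k) k) then 1 else 0)" for j
  have "cols (\<lambda>k. y (f k)) e k = base k" if "k < m" for k
  proof -
    have "inv_into {..<m} f (f k) = k" using inj that by simp
    then have "y (f k) (unshift (e k) i) = (if i = k then 1 else 0)" for i
      using unshift_inj by (auto simp: y_def)
    then show ?thesis by (simp add: cols_def base_def)
  qed
  then show ?thesis using that by blast
qed

text \<open>The points move one at a time, each changing the degree by a multiple of
  \<open>r\<close>; \<open>f s\<close> records that those below \<open>s\<close> have moved.\<close>

lemma deg_gen_pos:
  assumes z: "gen_pos z"
  shows "int r dvd deg (\<lambda>k. z (m + k)) - deg z"
proof -
  define f where "f s k = (if k < s then m + k else k)" for s k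
  have fr: "f s \<in> {..<m} \<rightarrow> {..<2 * m}" for s by (auto simp: f_def)
  have fi: "inj_on (f s) {..<m}" for s by (auto simp: f_def inj_on_def split: if_splits)
  have "s \<le> m \<Longrightarrow> int r dvd deg (\<lambda>k. z (f s k)) - deg z" for s
  proof (induction s)
    case 0
    then show ?case by (simp add: f_def)
  next
    case (Suc s)
    let ?x = "\<lambda>k. z (f s k)"
    have eq: "(\<lambda>k. z (f (Suc s) k)) = ?x(s := z (m + s))"
      by (auto simp: f_def fun_eq_iff less_Suc_eq)
    have "int r dvd deg (?x(s := z (m + s))) - deg ?x"
    proof (cases "s \<in> I")
      case False
      then have "deg (?x(s := z (m + s))) = deg ?x" by (intro deg_cong) auto
      then show ?thesis by simp
    next
      case True
      have er: "(\<lambda>k. q k mod r) \<in> {..<m} \<rightarrow> {..<r}" for q :: "nat \<Rightarrow> nat" using r by auto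
      \<comment> \<open>Column \<open>l\<close> receives the new position of \<open>s\<close> in the
        color of \<open>s\<close>. No column uses the index \<open>m + s\<close> yet, so the
        selection stays injective.\<close>
      have upd: "(facet ?x q)(l := \<lambda>i. z (m + s) (unshift (q s mod r) i)) =
          cols (\<lambda>k. z (((f s)(l := m + s)) k)) ((\<lambda>k. q k mod r)(l := q s mod r))"
        if "l \<in> I" for l and q :: "nat \<Rightarrow> nat"
        using that by (auto simp: cols_def I_def fun_eq_iff)
      have ur: "(f s)(l := m + s) \<in> {..<m} \<rightarrow> {..<2 * m}" for l
        using fr[of s] Suc.prems by auto
      have ui: "inj_on ((f s)(l := m + s)) {..<m}" for l
        using Suc.prems by (auto simp: f_def inj_on_def split: if_splits)
      have ue: "(\<lambda>k. q k mod r)(l := q s mod r) \<in> {..<m} \<rightarrow> {..<r}" for l and q :: "nat \<Rightarrow> nat"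
        using r by auto
      show ?thesis
      proof (rule deg_replace_point[OF True])
        fix q
        show "cdet m (facet ?x q) \<noteq> 0" by (rule gen_posD(1)[OF z fr er fi])
        fix l assume l: "l \<in> I"
        show "cdet m ((facet ?x q)(l := v)) \<noteq> 0" by (rule gen_posD(2)[OF z fr er fi l])
        show "cdet m ((facet ?x q)(l := \<lambda>i. z (m + s) (unshift (q s mod r) i))) \<noteq> 0"
          unfolding upd[OF l] by (rule gen_posD(1)[OF z ur ue ui])
        fix k assume k: "k \<in> I"
        show "cdet m ((facet ?x q)(l := \<lambda>i. z (m + s) (unshift (q s mod r) i), k := v)) \<noteq> 0"
          unfolding upd[OF l] by (rule gen_posD(2)[OF z ur ue ui k])
      qed
    qed
    moreover have "int r dvd deg ?x - deg z" using Suc by simp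
    ultimately have "int r dvd (deg (?x(s := z (m + s))) - deg ?x) + (deg ?x - deg z)" by (rule dvd_add)
    then show ?case unfolding eq by simp
  qed
  from this[of m] have "int r dvd deg (\<lambda>k. z (f m k)) - deg z" by simp
  moreover have "deg (\<lambda>k. z (f m k)) = deg (\<lambda>k. z (m + k))"
    by (rule deg_cong) (simp add: f_def I_def)
  ultimately show ?thesis by simp
qed

text \<open>
  The reference configuration puts all points of class \<open>j\<close> at the \<open>j\<close>-th unit vector.
\<close>

definition corner :: "nat \<Rightarrow> nat \<Rightarrow> real" where
  "corner k i = (if i = k div r * r then 1 else 0)"

text \<open>Off the slots, column \<open>k\<close> of the facet is the unit vector at
  \<open>q k\<close>; reading the rows along \<open>q\<close> moves its 1 to
  \<open>k\<close>.\<close>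

lemma facet_corner:
  assumes q: "q \<in> G"
  shows "facet corner q k (q i) = base k i"
proof (cases "k mod r = 0")
  case True
  then show ?thesis using G_div[OF q] by (simp add: cols_def base_def diag_def)
next
  case False
  have "q k mod r + (r - q k mod r) = r" using r by (simp add: less_imp_le)
  then have "unshift (q k mod r) (q k) = k div r * r"
    using G_div[OF q] by (simp add: unshift_def)
  then have "unshift (q k mod r) (q i) = k div r * r \<longleftrightarrow> i = k"
    using unshift_inj G_inj[OF q] by metis
  then show ?thesis using False by (simp add: cols_def base_def corner_def)
qed

section \<open>The degree of the reference configuration\<close>

lemma sign_sq: "of_int (sign p) * (of_int (sign p) :: real) = 1"
  by (simp add: sign_def)

lemma sign_cancel: "real_of_int (sign p) * a * (of_int (sign p) * b) = a * b"
  by (simp add: sign_def)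

lemma cdet_corner:
  assumes q: "q \<in> G"
  shows "cdet m (facet corner q) = sign q"
proof -
  have "real_of_int (sign q) * cdet m (facet corner q) = cdet m base"
    using cdet_permute_rows[OF G_perm[OF q], of "facet corner q"] by (simp add: facet_corner[OF q])
  then have "real_of_int (sign q) * (real_of_int (sign q) * cdet m (facet corner q)) = sign q"
    by (simp add: cdet_base)
  then show ?thesis by (simp add: mult.assoc[symmetric] sign_sq)
qed

text \<open>The coefficient vanishes when neither \<open>l\<close> nor its slot gets color 0, so
  near \<open>corner\<close> the sign of this determinant is controlled only in the other
  cases.\<close>

lemma cdet_corner_v:
  assumes q: "q \<in> G" and l: "l \<in> I"
  shows "cdet m ((facet corner q)(l := v)) = (v (q l) - v (q (l div r * r))) * sign q"
proof -
  have "real_of_int (sign q) * cdet m ((facet corner q)(l := v)) =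
      cdet m (\<lambda>k i. ((facet corner q)(l := v)) k (q i))"
    by (rule cdet_permute_rows[OF G_perm[OF q], symmetric])
  also have "\<dots> = cdet m (base(l := \<lambda>i. v (q i)))"
    by (rule cdet_cong) (simp add: facet_corner[OF q])
  also have "\<dots> = v (q l) - v (q (l div r * r))" by (rule cdet_base_replace[OF l])
  finally have "real_of_int (sign q) * (real_of_int (sign q) * cdet m ((facet corner q)(l := v))) =
      (v (q l) - v (q (l div r * r))) * sign q" by simp
  then show ?thesis by (simp add: mult.assoc[symmetric] sign_sq)
qed

text \<open>In these facets no class uses color 0. At \<open>corner\<close> exactly their cones
  contain \<open>v\<close>, the sum of the unit vectors in all nonzero colors.\<close>

definition G0 where "G0 = {q\<in>G. \<forall>k. q (k div r * r) = k div r * r}"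

text \<open>The hypotheses are open conditions that hold at \<open>corner\<close>, so a perturbation
  can keep them. They suffice: inside \<open>G0\<close> no coefficient vanishes, and outside one
  negative coefficient excludes the facet.\<close>

lemma deg_near_corner:
  assumes pos: "\<And>q. q \<in> G \<Longrightarrow> sign q * cdet m (facet x q) > 0"
    and posv: "\<And>q l. q \<in> G \<Longrightarrow> l \<in> I \<Longrightarrow> v (q l) - v (q (l div r * r)) \<noteq> 0 \<Longrightarrow>
      (v (q l) - v (q (l div r * r))) * sign q * cdet m ((facet x q)(l := v)) > 0"
  shows "deg x = card G0"
proof -
  have "sign q * cone_sign m I (facet x q) v = (if q \<in> G0 then 1 else 0)" if q: "q \<in> G" for q
  proof (cases "q \<in> G0")
    case True
    have fixd: "q (k div r * r) = k div r * r" for k using True by (auto simp: G0_def)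
    have "cdet m ((facet x q)(l := v)) * cdet m (facet x q) > 0" if l: "l \<in> I" for l
    proof -
      have "q l \<in> I"
      proof -
        have "q l mod r \<noteq> 0"
        proof
          assume "q l mod r = 0"
          then have "q l = l div r * r" by (rule slot_eqI[OF G_div[OF q]])
          then have "l = l div r * r" using fixd[of l] G_inj[OF q] by metis
          then show False using l slot_notin_I by metis
        qed
        then show ?thesis using G_lt[OF q] l by (simp add: I_def)
      qed
      then have "sign q * cdet m ((facet x q)(l := v)) > 0"
        using posv[OF q l] by (simp add: fixd v_slot v_I)
      then have "(sign q * cdet m ((facet x q)(l := v))) * (sign q * cdet m (facet x q)) > 0"
        using pos[OF q] by simp
      then show ?thesis by (simp only: sign_cancel)
    qed
    then show ?thesis using pos[OF q] True
      by (auto simp: cone_sign_def sign_def split: if_splits)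
  next
    case False
    then obtain k where k: "q (k div r * r) \<noteq> k div r * r" using q by (auto simp: G0_def)
    let ?s = "k div r * r"
    \<comment> \<open>The index of this class that takes color 0; its coefficient is
      \<open>0 - 1\<close>.\<close>
    define l where "l = inv_into UNIV q ?s"
    have ql: "q l = ?s" unfolding l_def using permutes_inverses(1)[OF G_perm[OF q]] .
    have ld: "l div r = k div r" using G_div[OF q, of l] ql r by simp
    have "?s < m"
      using k permutes_not_in[OF G_perm[OF q], of ?s] by (meson lessThan_iff)
    then have "l < m" using ld r by (simp add: less_m_iff)
    moreover have "l mod r \<noteq> 0"
    proof
      assume "l mod r = 0"
      then have "l = ?s" by (rule slot_eqI[OF ld])
      then show False using k ql by simp
    qed
    ultimately have l: "l \<in> I" by (simp add: I_def)
    have "q ?s mod r \<noteq> 0"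
    proof
      assume "q ?s mod r = 0"
      then have "q ?s = ?s" using slot_eqI[of "q ?s" k] G_div[OF q, of ?s] r by simp
      then show False using k by simp
    qed
    then have co: "v (q l) - v (q (l div r * r)) = - 1"
      by (simp add: ql ld v_def)
    have neg: "sign q * cdet m ((facet x q)(l := v)) < 0" using posv[OF q l] unfolding co by simp
    have "(sign q * cdet m ((facet x q)(l := v))) * (sign q * cdet m (facet x q)) < 0"
      using neg pos[OF q] by (rule mult_neg_pos)
    then have "\<not> cdet m ((facet x q)(l := v)) * cdet m (facet x q) > 0"
      by (simp only: sign_cancel not_less less_imp_le)
    then have "cone_sign m I (facet x q) v = 0" using l by (auto simp: cone_sign_def)
    then show ?thesis using False by simp
  qed
  then have "deg x = (\<Sum>q\<in>G. if q \<in> G0 then 1 else 0)" unfolding deg_def by (intro sum.cong) auto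
  also have "\<dots> = (\<Sum>q\<in>G0. 1)"
    by (rule sum.mono_neutral_cong_right[OF G_finite]) (auto simp: G0_def)
  finally show ?thesis by simp
qed

text \<open>\<open>G0\<close> is a product over the classes of the permutations of the nonzero
  colors; \<open>\<Phi>\<close> glues them and \<open>\<Psi>\<close> restricts to each
  class.\<close>

lemma card_G0: "card G0 = fact (r - 1) ^ n"
proof -
  let ?P = "{p. p permutes {1..<r}}"
  define \<Phi> where "\<Phi> p k = (if k < m then k div r * r + p (k div r) (k mod r) else k)"
    for p :: "nat \<Rightarrow> nat \<Rightarrow> nat" and k
  define \<Psi> where "\<Psi> q = (\<lambda>j\<in>{..<n}. \<lambda>i. if i < r then q (j * r + i) mod r else i)"
    for q :: "nat \<Rightarrow> nat"
  have plt: "p i < r" if "p \<in> ?P" "i < r" for p i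
    using permutes_in_image[of p "{1..<r}" i] permutes_not_in[of p "{1..<r}" i] that
    by (cases "i = 0") auto
  have p0: "p 0 = 0" if "p \<in> ?P" for p using that permutes_not_in by fastforce
  have jr: "j * r + i < m" if "j < n" "i < r" for i j
    using that by (simp add: less_m_iff)
  have \<Phi>: "\<Phi> p \<in> G0" if p: "p \<in> {..<n} \<rightarrow>\<^sub>E ?P" for p
  proof -
    have pj: "p (k div r) \<in> ?P" if "k < m" for k
      using p that by (auto simp: less_m_iff)
    have pl: "p (k div r) (k mod r) < r" if "k < m" for k
      using plt[OF pj[OF that]] r by simp
    have dv: "\<Phi> p k div r = k div r" for k
      using block_div[OF pl[of k]] by (cases "k < m") (simp_all add: \<Phi>_def)
    have md: "\<Phi> p k mod r = p (k div r) (k mod r)" if "k < m" for k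
      using block_mod[OF pl[OF that]] that by (simp add: \<Phi>_def)
    have "\<Phi> p permutes {..<m}"
    proof (rule inj_imp_permutes)
      show "inj_on (\<Phi> p) {..<m}"
      proof (rule inj_onI)
        fix a b assume ab: "a \<in> {..<m}" "b \<in> {..<m}" "\<Phi> p a = \<Phi> p b"
        have d: "a div r = b div r" using dv ab by metis
        have "p (a div r) (a mod r) = p (a div r) (b mod r)"
          using md[of a] md[of b] ab d by simp
        moreover have "inj (p (a div r))" using pj[of a] ab permutes_inj by auto
        ultimately have "a mod r = b mod r" by (simp add: inj_eq)
        with d show "a = b" by (rule nat_eq_div_mod)
      qed
      show "\<And>k. k \<in> {..<m} \<Longrightarrow> \<Phi> p k \<in> {..<m}" by (simp add: less_m_iff dv)
    qed (simp_all add: \<Phi>_def)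
    moreover have "\<Phi> p (k div r * r) = k div r * r" for k
    proof (cases "k div r * r < m")
      case True
      then have "p (k div r) 0 = 0" using p0[OF pj[OF True]] r by simp
      then show ?thesis using r by (simp add: \<Phi>_def)
    qed (simp add: \<Phi>_def)
    ultimately show ?thesis by (simp add: G0_def G_def dv)
  qed
  have \<Psi>: "\<Psi> q \<in> {..<n} \<rightarrow>\<^sub>E ?P" if q: "q \<in> G0" for q
  proof -
    have qG: "q \<in> G" and q0: "q (k div r * r) = k div r * r" for k
      using q by (auto simp: G0_def)
    have "\<Psi> q j permutes {1..<r}" if j: "j < n" for j
    proof (rule inj_imp_permutes)
      have e: "\<Psi> q j i = q (j * r + i) mod r" if "i < r" for i using that j by (simp add: \<Psi>_def)
      have qd: "q (j * r + i) div r = j" if "i < r" for i using G_div[OF qG] that by simp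
      have inj: "a = b" if "a < r" "b < r" "\<Psi> q j a = \<Psi> q j b" for a b
      proof -
        have "q (j * r + a) = q (j * r + b)"
          by (rule nat_eq_div_mod) (use that qd e in auto)
        then show ?thesis using G_inj[OF qG] by fastforce
      qed
      then show "inj_on (\<Psi> q j) {1..<r}" by (auto simp: inj_on_def)
      have z: "\<Psi> q j 0 = 0" using e[of 0] q0[of "j * r"] r by simp
      show "\<Psi> q j i \<in> {1..<r}" if i: "i \<in> {1..<r}" for i
      proof -
        have "\<Psi> q j i \<noteq> 0" using inj[of i 0] z i by auto
        moreover have "\<Psi> q j i < r" using e[of i] i r by simp
        ultimately show ?thesis by simp
      qed
      show "\<Psi> q j i = i" if "i \<notin> {1..<r}" for i
        using that z j by (cases "i = 0") (auto simp: \<Psi>_def)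
    qed simp
    then show ?thesis by (auto simp: \<Psi>_def PiE_def)
  qed
  have "bij_betw \<Phi> ({..<n} \<rightarrow>\<^sub>E ?P) G0"
  proof (rule bij_betw_byWitness[where f' = \<Psi>])
    show "\<forall>p\<in>{..<n} \<rightarrow>\<^sub>E ?P. \<Psi> (\<Phi> p) = p"
    proof
      fix p assume p: "p \<in> {..<n} \<rightarrow>\<^sub>E ?P"
      show "\<Psi> (\<Phi> p) = p"
      proof
        fix j
        show "\<Psi> (\<Phi> p) j = p j"
        proof (cases "j < n")
          case True
          then have pj: "p j \<in> ?P" using p by auto
          have "\<Psi> (\<Phi> p) j i = p j i" for i
          proof (cases "i < r")
            case i: True
            then show ?thesis using True jr[OF True i] plt[OF pj i] by (simp add: \<Psi>_def \<Phi>_def)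
          next
            case i: False
            then have "p j i = i" using pj permutes_not_in by fastforce
            then show ?thesis using True i by (simp add: \<Psi>_def)
          qed
          then show ?thesis by blast
        next
          case False
          then show ?thesis using p by (auto simp: \<Psi>_def PiE_def extensional_def)
        qed
      qed
    qed
    show "\<forall>q\<in>G0. \<Phi> (\<Psi> q) = q"
    proof
      fix q assume "q \<in> G0"
      then have q: "q \<in> G" by (simp add: G0_def)
      show "\<Phi> (\<Psi> q) = q"
      proof
        fix k
        show "\<Phi> (\<Psi> q) k = q k"
        proof (cases "k < m")
          case True
          have "k div r * r + q k mod r = q k" using G_div[OF q, of k] by (metis div_mult_mod_eq)
          then show ?thesis using True r by (simp add: \<Phi>_def \<Psi>_def less_m_iff)
        next
          case False
          then show ?thesis using permutes_not_in[OF G_perm[OF q], of k] by (simp add: \<Phi>_def)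
        qed
      qed
    qed
  qed (use \<Phi> \<Psi> in auto)
  then have "card G0 = card ({..<n} \<rightarrow>\<^sub>E ?P)" using bij_betw_same_card by metis
  also have "\<dots> = (\<Prod>j<n. card ?P)" by (simp add: card_PiE)
  also have "card ?P = fact (r - 1)" by (rule card_permutations) auto
  finally show ?thesis by simp
qed

section \<open>Nonzero degree against separating functionals\<close>

lemma line_poly_cols: "line_poly (\<lambda>z. cols (\<lambda>k. z (f k)) e k i)"
  by (cases "k mod r = 0") (simp_all add: cols_def line_poly_const line_poly_coord)

lemma line_poly_cols_upd: "line_poly (\<lambda>z. ((cols (\<lambda>k. z (f k)) e)(l := w)) k i)"
  by (cases "k = l") (simp_all add: line_poly_const line_poly_cols)

lemma line_poly_cdet_cols:
  "line_poly (\<lambda>z. cdet m (cols (\<lambda>k. z (f k)) e))"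
  "line_poly (\<lambda>z. cdet m ((cols (\<lambda>k. z (f k)) e)(l := w)))"
  by (intro line_poly_cdet line_poly_cols line_poly_cols_upd)+

text \<open>The easy half of Farkas: if \<open>w\<close> had positive coefficients on
  \<open>I\<close>, then \<open>Y\<close>, which kills the other columns, would be nonnegative on
  \<open>w\<close>.\<close>

lemma cone_sign_eq_0_if_separated:
  assumes diag0: "\<And>k. k < m \<Longrightarrow> k \<notin> I \<Longrightarrow> (\<Sum>i<m. Y i * F k i) = 0"
    and pos: "\<And>k. k \<in> I \<Longrightarrow> (\<Sum>i<m. Y i * F k i) > 0"
    and neg: "(\<Sum>i<m. Y i * w i) < 0"
  shows "cone_sign m I F w = 0"
proof (rule ccontr)
  assume "cone_sign m I F w \<noteq> 0"
  then have d: "cdet m F \<noteq> 0" and c: "\<And>l. l \<in> I \<Longrightarrow> cdet m (F(l := w)) * cdet m F > 0"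
    by (auto simp: cone_sign_def split: if_splits)
  obtain s where s: "\<And>i. i < m \<Longrightarrow> w i = (\<Sum>k<m. s k * F k i)" using cdet_solve[OF d, of w] by metis
  have sp: "s k > 0" if "k \<in> I" for k
  proof -
    have "s k * (cdet m F * cdet m F) > 0"
      using c[OF that] cdet_cramer[of m w s F k, OF s] that I_sub by (auto simp: mult.assoc)
    moreover have "cdet m F * cdet m F > 0" using d by (simp add: zero_less_mult_iff linorder_neq_iff disj_commute)
    ultimately show ?thesis using zero_less_mult_pos2 by blast
  qed
  have "(\<Sum>i<m. Y i * w i) = (\<Sum>i<m. \<Sum>k<m. s k * (Y i * F k i))"
    by (intro sum.cong refl) (simp add: s sum_distrib_left mult_ac)
  also have "\<dots> = (\<Sum>k<m. s k * (\<Sum>i<m. Y i * F k i))"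
    by (subst sum.swap) (simp add: sum_distrib_left)
  also have "\<dots> \<ge> 0"
  proof (rule sum_nonneg)
    fix k assume "k \<in> {..<m}"
    then show "s k * (\<Sum>i<m. Y i * F k i) \<ge> 0"
      using sp[of k] pos[of k] diag0[of k] by (cases "k \<in> I") (auto intro: less_imp_le)
  qed
  finally show False using neg by simp
qed

text \<open>Otherwise a perturbation of \<open>x\<close> has degree 0 while one of
  \<open>corner\<close> has degree \<open>fact (r - 1) ^ n\<close>. The two are congruent modulo
  \<open>r\<close>, but the prime \<open>r\<close> does not divide the latter.\<close>

lemma not_all_separated:
  assumes prime: "prime r"
  shows "\<exists>q\<in>G. \<nexists>Y. (\<forall>k. (\<Sum>i<m. Y i * diag k i) = 0) \<and>
    (\<forall>k\<in>I. (\<Sum>i<m. Y i * facet x q k i) > 0) \<and> (\<Sum>i<m. Y i * v i) < 0"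
proof (rule ccontr)
  assume "\<not> ?thesis"
  then have "\<forall>q\<in>G. \<exists>Y. (\<forall>k. (\<Sum>i<m. Y i * diag k i) = 0) \<and>
    (\<forall>k\<in>I. (\<Sum>i<m. Y i * facet x q k i) > 0) \<and> (\<Sum>i<m. Y i * v i) < 0" by blast
  then obtain Y where "\<forall>q\<in>G. (\<forall>k. (\<Sum>i<m. Y q i * diag k i) = 0) \<and>
    (\<forall>k\<in>I. (\<Sum>i<m. Y q i * facet x q k i) > 0) \<and> (\<Sum>i<m. Y q i * v i) < 0"
    by (rule bchoice[THEN exE])
  then have Y: "\<And>q k. q \<in> G \<Longrightarrow> (\<Sum>i<m. Y q i * diag k i) = 0"
    "\<And>q k. q \<in> G \<Longrightarrow> k \<in> I \<Longrightarrow> (\<Sum>i<m. Y q i * facet x q k i) > 0"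
    "\<And>q. q \<in> G \<Longrightarrow> (\<Sum>i<m. Y q i * v i) < 0"
    by blast+
  define c where "c q l = v (q l) - v (q (l div r * r))" for q l
  \<comment> \<open>\<open>Q1\<close> keeps the separations at \<open>x\<close>, \<open>Q2\<close>
    and \<open>Q3\<close> the signs of the nonzero determinants at \<open>corner\<close>;
    \<open>P1\<close> and \<open>P2\<close> express general position.\<close>
  define Q1 where "Q1 = (\<lambda>(q, k) z. \<Sum>i<m. Y q i * facet z q k i)"
  define Q2 where "Q2 = (\<lambda>q z. sign q * cdet m (facet (\<lambda>k. z (m + k)) q))"
  define Q3 where "Q3 = (\<lambda>(q, l) z. c q l * sign q * cdet m ((facet (\<lambda>k. z (m + k)) q)(l := v)))"
  define S3 where "S3 = {(q, l) \<in> G \<times> I. c q l \<noteq> 0}"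
  define FE where "FE = {(f, e). f \<in> {..<m} \<rightarrow>\<^sub>E {..<2 * m} \<and> e \<in> {..<m} \<rightarrow>\<^sub>E {..<r} \<and> inj_on f {..<m}}"
  define P1 where "P1 = (\<lambda>(f, e) (z :: nat \<Rightarrow> nat \<Rightarrow> real). cdet m (cols (\<lambda>k. z (f k)) e))"
  define P2 where "P2 = (\<lambda>((f, e), l) (z :: nat \<Rightarrow> nat \<Rightarrow> real). cdet m ((cols (\<lambda>k. z (f k)) e)(l := v)))"
  define z0 where "z0 j = (if j < m then x j else corner (j - m))" for j
  let ?P = "P1 ` FE \<union> P2 ` (FE \<times> I)"
  let ?Q = "Q1 ` (G \<times> I) \<union> Q2 ` G \<union> Q3 ` S3"
  have FE: "finite FE"
    by (rule finite_subset[of _ "({..<m} \<rightarrow>\<^sub>E {..<2 * m}) \<times> ({..<m} \<rightarrow>\<^sub>E {..<r})"])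
      (auto simp: FE_def intro!: finite_PiE)
  have S3: "finite S3"
    by (rule finite_subset[of _ "G \<times> I"]) (auto simp: S3_def G_finite I_fin)
  have "\<exists>z. (\<forall>P\<in>?P. P z \<noteq> 0) \<and> (\<forall>Q\<in>?Q. Q z > 0)"
  proof (rule generic_perturbation)
    show "finite ?P" using FE I_fin by blast
    show "finite ?Q" using G_finite I_fin S3 by blast
    fix P assume "P \<in> ?P"
    then consider f e where "(f, e) \<in> FE" "P = P1 (f, e)"
      | f e l where "(f, e) \<in> FE" "l \<in> I" "P = P2 ((f, e), l)" by auto
    then show "line_poly P \<and> (\<exists>y. P y \<noteq> 0)"
    proof cases
      case (1 f e)
      then have "inj_on f {..<m}" by (simp add: FE_def)
      then obtain y where y: "\<And>k. k < m \<Longrightarrow> cols (\<lambda>k. y (f k)) e k = base k"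
        using cols_eq_base_exists[of f e] by blast
      have "cdet m (cols (\<lambda>k. y (f k)) e) = cdet m base" by (rule cdet_cong) (simp add: y)
      then have "P y \<noteq> 0" using 1 by (simp add: P1_def cdet_base)
      then show ?thesis using line_poly_cdet_cols(1) 1 by (auto simp: P1_def)
    next
      case (2 f e l)
      then have "inj_on f {..<m}" by (simp add: FE_def)
      then obtain y where y: "\<And>k. k < m \<Longrightarrow> cols (\<lambda>k. y (f k)) e k = base k"
        using cols_eq_base_exists[of f e] by blast
      have "cdet m ((cols (\<lambda>k. y (f k)) e)(l := v)) = cdet m (base(l := v))"
        by (rule cdet_cong) (simp add: y)
      then have "P y \<noteq> 0" using 2 by (simp add: P2_def cdet_base_replace v_slot v_I)
      then show ?thesis using line_poly_cdet_cols(2) 2 by (auto simp: P2_def)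
    qed
  next
    fix Q assume "Q \<in> ?Q"
    have A0: "facet z0 q k = facet x q k" if "k \<in> I" for q k using that by (simp add: cols_def z0_def I_def)
    have A1: "(\<lambda>k. z0 (m + k)) = corner" by (simp add: z0_def)
    from \<open>Q \<in> ?Q\<close> consider q k where "q \<in> G" "k \<in> I" "Q = Q1 (q, k)" | q where "q \<in> G" "Q = Q2 q"
      | q l where "q \<in> G" "l \<in> I" "c q l \<noteq> 0" "Q = Q3 (q, l)" by (auto simp: S3_def)
    then show "line_poly Q \<and> Q z0 > 0"
    proof cases
      case (1 q k)
      have "line_poly Q"
        unfolding 1 Q1_def split
        by (intro line_poly_sum line_poly_mult line_poly_const line_poly_cols[of "\<lambda>k. k"])
      then show ?thesis using 1 Y(2) by (simp add: Q1_def A0)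
    next
      case (2 q)
      have "line_poly Q"
        unfolding 2 Q2_def by (intro line_poly_mult line_poly_const line_poly_cdet_cols)
      then show ?thesis using 2 by (simp add: Q2_def A1 cdet_corner sign_sq)
    next
      case (3 q l)
      have "line_poly Q"
        unfolding 3 Q3_def split by (intro line_poly_mult line_poly_const line_poly_cdet_cols)
      moreover have "Q z0 = c q l * c q l"
        using 3 by (simp add: Q3_def A1 cdet_corner_v c_def[symmetric] sign_def)
      ultimately show ?thesis using 3 by (simp add: zero_less_mult_iff linorder_neq_iff disj_commute)
    qed
  qed
  then obtain z where z: "\<forall>P\<in>?P. P z \<noteq> 0" "\<forall>Q\<in>?Q. Q z > 0" by (elim exE conjE)
  have zP1: "P1 p z \<noteq> 0" if "p \<in> FE" for p by (rule bspec[OF z(1) UnI1[OF imageI[OF that]]])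
  have zP2: "P2 p z \<noteq> 0" if "p \<in> FE \<times> I" for p by (rule bspec[OF z(1) UnI2[OF imageI[OF that]]])
  have zQ1: "Q1 p z > 0" if "p \<in> G \<times> I" for p by (rule bspec[OF z(2) UnI1[OF UnI1[OF imageI[OF that]]]])
  have zQ2: "Q2 q z > 0" if "q \<in> G" for q by (rule bspec[OF z(2) UnI1[OF UnI2[OF imageI[OF that]]]])
  have zQ3: "Q3 p z > 0" if "p \<in> S3" for p by (rule bspec[OF z(2) UnI2[OF imageI[OF that]]])
  have "gen_pos z"
    unfolding gen_pos_def
  proof (intro ballI impI conjI)
    fix f e assume fe: "f \<in> {..<m} \<rightarrow>\<^sub>E {..<2 * m}" "e \<in> {..<m} \<rightarrow>\<^sub>E {..<r}" "inj_on f {..<m}"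
    then have FE': "(f, e) \<in> FE" by (simp add: FE_def)
    show "cdet m (cols (\<lambda>k. z (f k)) e) \<noteq> 0"
      using zP1[of "(f, e)"] FE' by (simp add: P1_def)
    fix l assume "l \<in> I"
    then show "cdet m ((cols (\<lambda>k. z (f k)) e)(l := v)) \<noteq> 0"
      using zP2[of "((f, e), l)"] FE' by (simp add: P2_def)
  qed
  then have "int r dvd deg (\<lambda>k. z (m + k)) - deg z" by (rule deg_gen_pos)
  moreover have "deg z = 0"
    unfolding deg_def
  proof (rule sum.neutral, rule ballI)
    fix q assume q: "q \<in> G"
    have "cone_sign m I (facet z q) v = 0"
    proof (rule cone_sign_eq_0_if_separated[of "Y q"])
      fix k assume "k < m" "k \<notin> I"
      then have "facet z q k = diag k" by (simp add: I_def cols_def)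
      then show "(\<Sum>i<m. Y q i * facet z q k i) = 0" using Y(1)[OF q] by simp
    next
      fix k assume "k \<in> I"
      then show "(\<Sum>i<m. Y q i * facet z q k i) > 0" using zQ1[of "(q, k)"] q by (simp add: Q1_def)
    qed (rule Y(3)[OF q])
    then show "sign q * cone_sign m I (facet z q) v = 0" by simp
  qed
  moreover have "deg (\<lambda>k. z (m + k)) = card G0"
  proof (rule deg_near_corner)
    fix q assume q: "q \<in> G"
    show "sign q * cdet m (facet (\<lambda>k. z (m + k)) q) > 0" using zQ2[of q] q by (simp add: Q2_def)
    fix l assume "l \<in> I" "v (q l) - v (q (l div r * r)) \<noteq> 0"
    then show "(v (q l) - v (q (l div r * r))) * sign q * cdet m ((facet (\<lambda>k. z (m + k)) q)(l := v)) > 0"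
      using zQ3[of "(q, l)"] q by (simp add: Q3_def S3_def c_def)
  qed
  ultimately have "int r dvd int (card G0)" by simp
  then have "r dvd fact (r - 1) ^ n" by (simp only: of_nat_dvd_iff card_G0)
  then have "r dvd fact (r - 1)" using prime prime_dvd_power by blast
  then show False using prime r by (simp add: prime_dvd_fact_iff)
qed

lemma sum_blocks: "(\<Sum>i<m. h i) = (\<Sum>j<n. \<Sum>c<r. h (j * r + c))"
proof -
  have "(\<Sum>i<m. h i) = (\<Sum>j<n. sum h {j * r..<j * r + r})"
    unfolding m_def by (rule sum.nat_group[symmetric])
  also have "\<dots> = (\<Sum>j<n. \<Sum>c<r. h (j * r + c))"
  proof (rule sum.cong[OF refl])
    fix j
    show "sum h {j * r..<j * r + r} = (\<Sum>c<r. h (j * r + c))"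
      by (rule sum.reindex_bij_witness[where i = "\<lambda>c. j * r + c" and j = "\<lambda>i. i - j * r"]) auto
  qed
  finally show ?thesis .
qed

end

subsection \<open>The colored Tverberg theorem\<close>

text \<open>In the application \<open>w\<close> is a point minus the single point \<open>c0\<close>
  of the last class. In these homogeneous coordinates \<open>c0\<close> is the all-ones vector, so
  modulo the diagonal \<open>v\<close> is minus its copy in color 0. The subtracted basis sum
  compensates the added ones.\<close>

lemma sum_affine_coordinates:
  fixes y w :: "'a::euclidean_space"
  assumes b: "bij_betw b {1..DIM('a)} Basis"
  shows "(\<Sum>j<DIM('a) + 1. (if j = 0 then f - (\<Sum>b\<in>Basis. y \<bullet> b) else y \<bullet> b j) *
    (if j = 0 then 1 else 1 + w \<bullet> b j)) = f + y \<bullet> w"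
proof -
  have s: "{..<DIM('a) + 1} = insert 0 {1..DIM('a)}" by auto
  have "(\<Sum>j<DIM('a) + 1. (if j = 0 then f - (\<Sum>b\<in>Basis. y \<bullet> b) else y \<bullet> b j) *
      (if j = 0 then 1 else 1 + w \<bullet> b j)) =
      f - (\<Sum>b\<in>Basis. y \<bullet> b) + (\<Sum>j\<in>{1..DIM('a)}. (y \<bullet> b j) * (1 + w \<bullet> b j))"
    unfolding s by (subst sum.insert) (auto intro!: sum.cong)
  also have "(\<Sum>j\<in>{1..DIM('a)}. (y \<bullet> b j) * (1 + w \<bullet> b j)) = (\<Sum>b\<in>Basis. (y \<bullet> b) * (1 + w \<bullet> b))"
    by (rule sum.reindex_bij_betw[OF b])
  also have "\<dots> = (\<Sum>b\<in>Basis. y \<bullet> b) + y \<bullet> w"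
    by (subst euclidean_inner[of y w]) (simp add: distrib_left sum.distrib)
  finally show ?thesis by simp
qed

theorem theorem2:
  fixes C :: "nat \<Rightarrow> 'a::euclidean_space set" and r :: nat
  assumes "prime r"
    and "BMZ_collection r C"
  shows "\<exists>R :: nat \<Rightarrow> 'a set. Tverberg_rainbow_partition r C R"
proof -
  define d where "d = DIM('a)"
  have r1: "r > 1" using assms(1) by (rule prime_gt_1_nat)
  \<comment> \<open>Both the number of classes of size \<open>r - 1\<close> and the number of
    homogeneous coordinates, which makes a facet together with its slots a square matrix.\<close>
  define N where "N = d + 1"
  interpret color_grid N r by standard (use r1 in \<open>auto simp: N_def\<close>)
  have fin: "\<And>j. j \<in> {1..d + 2} \<Longrightarrow> finite (C j)"
    and disj: "\<And>i j. i \<in> {1..d + 2} \<Longrightarrow> j \<in> {1..d + 2} \<Longrightarrow> i \<noteq> j \<Longrightarrow> C i \<inter> C j = {}"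
    and card: "\<And>j. j \<in> {1..d + 1} \<Longrightarrow> card (C j) = r - 1" and "card (C (d + 2)) = 1"
    using assms(2) unfolding BMZ_collection_def d_def by blast+
  then obtain c0 where c0: "C (d + 2) = {c0}" using card_1_singletonE by blast
  \<comment> \<open>Position 0 of each class stays free for the slot.\<close>
  have "\<forall>j\<in>{..<N}. \<exists>g. bij_betw g {1..<r} (C (j + 1))"
    using fin card by (intro ballI finite_same_card_bij) (auto simp: N_def)
  then obtain g where g: "\<And>j. j < N \<Longrightarrow> bij_betw (g j) {1..<r} (C (j + 1))"
    by (metis lessThan_iff)
  have "\<exists>b. bij_betw b {1..d} (Basis :: 'a set)" by (rule finite_same_card_bij) (auto simp: d_def)
  then obtain b where b: "bij_betw b {1..d} (Basis :: 'a set)" by blast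
  define pt where "pt k = g (k div r) (k mod r)" for k
  define h where "h p j = (if j = 0 then 1 else 1 + (p - c0) \<bullet> b j)" for p j
  \<comment> \<open>Sarkaria's lift: the point sits in color 0, and \<open>cols\<close> rotates it
    to its assigned color.\<close>
  define x where "x k i = (if i mod r = 0 then h (pt k) (i div r) else 0)" for k i
  have kI: "k div r < N" "k mod r \<in> {1..<r}" if "k \<in> I" for k
    using that r1 by (auto simp: I_def less_m_iff)
  have ptC: "pt k \<in> C (k div r + 1)" if "k \<in> I" for k
    using bij_betwE[OF g[OF kI(1)[OF that]]] kI(2)[OF that] by (simp add: pt_def)
  have pt_block: "k div r + 1 = j" if "k \<in> I" "pt k \<in> C j" "j \<in> {1..d + 2}" for k j
    using disj[of "k div r + 1" j] ptC[OF that(1)] kI(1)[OF that(1)] that by (auto simp: disjoint_iff N_def)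
  have pt_inj: "k = l" if kl: "k \<in> I" "l \<in> I" "pt k = pt l" for k l
  proof (rule nat_eq_div_mod)
    show dv: "k div r = l div r" using pt_block[OF kl(1), of "l div r + 1"] ptC[OF kl(2)] kI[OF kl(2)] kl by (auto simp: N_def)
    have "inj_on (g (k div r)) {1..<r}" using g[OF kI(1)[OF kl(1)]] bij_betw_imp_inj_on by blast
    then show "k mod r = l mod r"
      using kl(3) kI(2)[OF kl(1)] kI(2)[OF kl(2)] dv unfolding pt_def by (auto dest: inj_onD)
  qed
  have pt_c0: "pt k \<noteq> c0" if "k \<in> I" for k
    using pt_block[OF that, of "d + 2"] kI[OF that] c0 by (auto simp: N_def)
  obtain q where q: "q \<in> G" and sep: "\<nexists>Y. (\<forall>k. (\<Sum>i<m. Y i * diag k i) = 0) \<and>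
    (\<forall>k\<in>I. (\<Sum>i<m. Y i * facet x q k i) > 0) \<and> (\<Sum>i<m. Y i * v i) < 0"
    using not_all_separated[OF assms(1), of x] by blast
  \<comment> \<open>Colors start at 0, the sets at 1. The point \<open>c0\<close> joins color 0, in
    accordance with \<open>v\<close>.\<close>
  define R where "R c = pt ` {k\<in>I. q k mod r + 1 = c} \<union> (if c = 1 then {c0} else {})" for c
  have finR: "finite (R c)" for c using I_fin by (simp add: R_def)
  \<comment> \<open>Otherwise functionals separating the hulls assemble to a \<open>Y\<close> of the
    kind that \<open>sep\<close> excludes.\<close>
  have R_hulls: "(\<Inter>i\<in>{1..r}. convex hull (R i)) \<noteq> {}"
  proof
    assume emp: "(\<Inter>i\<in>{1..r}. convex hull (R i)) = {}"
    have "(\<Inter>c<r. convex hull (R (c + 1))) = (\<Inter>i\<in>{1..r}. convex hull (R i))"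
    proof -
      have "{1..r} = (\<lambda>c. c + 1) ` {..<r}" using image_Suc_lessThan[of r] by simp
      then show ?thesis by (simp only: image_image)
    qed
    then have emp': "(\<Inter>c<r. convex hull (R (c + 1))) = {}" using emp by simp
    obtain y :: "nat \<Rightarrow> 'a" and e :: "nat \<Rightarrow> real" where y0: "(\<Sum>c<r. y c) = 0" and e0: "(\<Sum>c<r. e c) = 0"
      and pos: "\<And>c p. c < r \<Longrightarrow> p \<in> convex hull (R (c + 1)) \<Longrightarrow> y c \<bullet> p + e c > 0"
      by (rule separate_convex_compact_family[of r "\<lambda>c. convex hull (R (c + 1))"])
        (use r1 finR emp' in \<open>auto intro: finite_imp_compact_convex_hull\<close>)
    \<comment> \<open>The coefficients of the functional of color \<open>c\<close> in the
      coordinates \<open>h\<close> centered at \<open>c0\<close>.\<close>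
    define Z where "Z j c = (if j = 0 then y c \<bullet> c0 + e c - (\<Sum>b\<in>Basis. y c \<bullet> b) else y c \<bullet> b j)" for j c
    have Zh: "(\<Sum>j<N. Z j c * h p j) = y c \<bullet> p + e c" for c p
      using sum_affine_coordinates[of b "y c \<bullet> c0 + e c" "y c" "p - c0"] b
      by (simp add: Z_def h_def N_def d_def inner_diff_right)
    have Z0: "(\<Sum>c<r. Z j c) = 0" for j
    proof -
      have "(\<Sum>c<r. y c \<bullet> w) = 0" for w by (simp add: inner_sum_left[symmetric] y0)
      then have "(\<Sum>c<r. \<Sum>b\<in>Basis. y c \<bullet> b) = 0" "(\<Sum>c<r. y c \<bullet> w) = 0" for w
        by (simp_all add: sum.swap[of _ Basis])
      then show ?thesis by (cases "j = 0") (simp_all add: Z_def sum_subtractf sum.distrib e0)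
    qed
    define Y where "Y i = Z (i div r) (i mod r)" for i
    have Yb: "Y (j * r + c) = Z j c" if "c < r" for j c using that by (simp add: Y_def)
    have "(\<Sum>i<m. Y i * diag k i) = 0" for k
    proof -
      have "(\<Sum>i<m. Y i * diag k i) = (\<Sum>j<N. \<Sum>c<r. Z j c * (if j = k div r then 1 else 0))"
        unfolding sum_blocks by (intro sum.cong refl) (simp add: Yb diag_def)
      also have "\<dots> = (\<Sum>j<N. (\<Sum>c<r. Z j c) * (if j = k div r then 1 else 0))"
        by (simp only: sum_distrib_right)
      finally show ?thesis by (simp add: Z0)
    qed
    moreover have "(\<Sum>i<m. Y i * facet x q k i) > 0" if k: "k \<in> I" for k
    proof -
      define c where "c = q k mod r"
      have c: "c < r" using r1 by (simp add: c_def)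
      have "(\<Sum>i<m. Y i * facet x q k i) = (\<Sum>j<N. \<Sum>c'<r. if c' = c then Z j c * h (pt k) j else 0)"
        unfolding sum_blocks
      proof (intro sum.cong refl)
        fix j c' assume "j \<in> {..<N}" "c' \<in> {..<r}"
        then have c': "c' < r" by simp
        have "(c' + (r - c)) mod r = 0 \<longleftrightarrow> c' = c"
          using c c' add_mod_cases[of c' "r - c"] by (auto split: if_splits)
        then have "facet x q k (j * r + c') = (if c' = c then h (pt k) j else 0)"
          using k c' by (simp add: cols_def I_def x_def unshift_div unshift_mod c_def[symmetric])
        then show "Y (j * r + c') * facet x q k (j * r + c') = (if c' = c then Z j c * h (pt k) j else 0)"
          using Yb[OF c'] by simp
      qed
      also have "\<dots> = (\<Sum>j<N. Z j c * h (pt k) j)" using c by simp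
      also have "\<dots> = y c \<bullet> pt k + e c" by (rule Zh)
      also have "\<dots> > 0"
        by (rule pos[OF c]) (use k in \<open>auto simp: R_def c_def intro!: hull_inc\<close>)
      finally show ?thesis .
    qed
    \<comment> \<open>As \<open>Z j\<close> sums to 0 over the colors, leaving out color 0 yields
      minus the value of its functional at \<open>c0\<close>, a point of \<open>R 1\<close>.\<close>
    moreover have "(\<Sum>i<m. Y i * v i) < 0"
    proof -
      have h1: "h c0 j = 1" for j by (simp add: h_def)
      have "(\<Sum>i<m. Y i * v i) = (\<Sum>j<N. \<Sum>c<r. Z j c - (if c = 0 then Z j 0 else 0))"
        unfolding sum_blocks by (intro sum.cong refl) (auto simp: Yb v_def)
      also have "\<dots> = - (\<Sum>j<N. Z j 0 * h c0 j)"
        using r1 by (simp add: sum_subtractf Z0 h1 sum_negf)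
      also have "\<dots> = - (y 0 \<bullet> c0 + e 0)" by (simp only: Zh)
      also have "\<dots> < 0"
        using pos[of 0 c0] r1 by (simp add: R_def hull_inc)
      finally show ?thesis .
    qed
    ultimately show False using sep by blast
  qed
  have R_disj: "R i \<inter> R k = {}" if "i \<noteq> k" for i k
    using that pt_c0 by (auto simp: R_def dest: pt_inj split: if_splits)
  have R_sub: "R i \<subseteq> (\<Union>j\<in>{1..d + 2}. C j)" for i
  proof
    fix a assume "a \<in> R i"
    then consider k where "k \<in> I" "a = pt k" | "a = c0" by (auto simp: R_def split: if_splits)
    then show "a \<in> (\<Union>j\<in>{1..d + 2}. C j)"
    proof cases
      case (1 k)
      then show ?thesis using ptC[of k] kI(1)[of k] by (intro UN_I[of "k div r + 1"]) (auto simp: N_def)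
    next
      case 2
      then show ?thesis using c0 by (intro UN_I[of "d + 2"]) auto
    qed
  qed
  have R_card: "card (R i \<inter> C j) \<le> 1" if j: "j \<in> {1..d + 2}" for i j
  proof -
    have "a = a'" if a: "a \<in> R i \<inter> C j" "a' \<in> R i \<inter> C j" for a a'
    proof (cases "j = d + 2")
      case True
      then show ?thesis using a c0 by auto
    next
      case False
      then have "c0 \<notin> C j" using disj[of j "d + 2"] j c0 by auto
      then have "a \<noteq> c0" "a' \<noteq> c0" using a by auto
      then have "a \<in> pt ` {k\<in>I. q k mod r + 1 = i}" "a' \<in> pt ` {k\<in>I. q k mod r + 1 = i}"
        using a by (auto simp: R_def split: if_splits)
      then obtain k l where k: "k \<in> I" "a = pt k" "q k mod r + 1 = i"
        and l: "l \<in> I" "a' = pt l" "q l mod r + 1 = i" by blast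
      \<comment> \<open>Equal class and equal color give \<open>q k = q l\<close>, so injectivity of
        \<open>q\<close> identifies the two points.\<close>
      have "k div r + 1 = j" "l div r + 1 = j" using pt_block k l a j by auto
      then have "q k div r = q l div r" by (simp add: G_div[OF q])
      moreover have "q k mod r = q l mod r" using k l by simp
      ultimately have "q k = q l" by (rule nat_eq_div_mod)
      then show ?thesis using G_inj[OF q] k l by auto
    qed
    then have "card (R i \<inter> C j) \<le> Suc 0"
      using card_le_Suc0_iff_eq[of "R i \<inter> C j"] finR by blast
    then show ?thesis by simp
  qed
  show ?thesis
    unfolding Tverberg_rainbow_partition_def d_def[symmetric]
    by (intro exI[of _ R] conjI ballI impI R_disj R_sub R_card R_hulls)
qed

end
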